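(* Fix a prime power $q$, an integer $k\ge2$, and positive integers $c$ and $a_1,\dots,a_c$. Set $M=\sum_{i=1}^{c}(a_i-1)$. If $M=0$, assume $n\ge k$; if $M=1$, assume $n\ge2k+1$; and if $M\ge2$, assume $n\ge(2M+1)k-M+3$. Let $V$ be an $n$-dimensional vector space over $\mathbb{F}_q$. If $\mathcal{F}\subsetneq\mathrm{Gr}_k(V)$ satisfies $$\sigma_{k,q}(\mathcal{F})>\binom{k}{1}_q\left(\binom{n-1}{k-1}_q-q^{M(k-1)}\binom{n-M-1}{k-1}_q\right),$$ then every $c$-colouring of $\mathcal{F}$ contains, for some $i\in\{1,\dots,c\}$, a monochromatic direct-sum matching of size $a_i$ in colour $i$.
   Context: $\binom{a}{b}_q=\prod_{i=0}^{b-1}\frac{q^{a-i}-1}{q^{b-i}-1}$ is the Gaussian coefficient, with $\binom{a}{b}_q=0$ if $b<0$ or $b>a$. $\mathrm{Gr}_k(V)$ is the set of all $k$-dimensional subspaces of $V$; the elements of $\mathrm{Gr}_1(V)$ are called points. For a point $x$, $d_{\mathcal{F}}(x)=|\{F\in\mathcal{F}:x\le F\}|$; for $S\in\mathrm{Gr}_k(V)$, $d_{\mathcal{F}}(S)=\sum_{x\in\mathrm{Gr}_1(S)}d_{\mathcal{F}}(x)$. For $\mathcal{F}\ne\mathrm{Gr}_k(V)$ the projective Ore-degree is $\sigma_{k,q}(\mathcal{F})=\min\{d_{\mathcal{F}}(S):S\in\mathrm{Gr}_k(V)\setminus\mathcal{F}\}$. A direct-sum matching of size $s$ in $\mathcal{F}$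 is a collection $F_1,\dots,F_s\in\mathcal{F}$ with $\dim(F_1+\cdots+F_s)=sk$. A $c$-colouring of $\mathcal{F}$ is a map $\chi:\mathcal{F}\to\{1,\dots,c\}$. A direct-sum matching $F_1,\dots,F_s$ in $\mathcal F$ is monochromatic of colour $i$ if $\chi(F_1)=\cdots=\chi(F_s)=i$. *)

theory Defs
  imports
    "HOL-Library.FuncSet"
    "HOL-Library.Cardinality"
    "HOL-Library.Set_Algebras"
    Complex_Main
begin

text \<open>
  A vector space is given by a scalar multiplication \<open>scale\<close> satisfying the locale
  \<^locale>\<open>vector_space\<close>; subspaces are sets of vectors. Note that \<open>dim\<close> is \<open>0\<close> on
  infinite-dimensional spaces, so \<open>dim S = m\<close> with \<open>m > 0\<close> entails finite dimension.
\<close>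

definition gauss_binomial :: "nat \<Rightarrow> nat \<Rightarrow> nat \<Rightarrow> real" where
  "gauss_binomial q a b =
     (if b \<le> a then \<Prod>i<b. (real q ^ (a - i) - 1) / (real q ^ (b - i) - 1) else 0)"

definition Gr :: "('f::field \<Rightarrow> 'v::ab_group_add \<Rightarrow> 'v) \<Rightarrow> nat \<Rightarrow> 'v set \<Rightarrow> 'v set set" where
  "Gr scale k V = {S. module.subspace scale S \<and> S \<subseteq> V \<and> vector_space.dim scale S = k}"

definition point_degree :: "'v set set \<Rightarrow> 'v set \<Rightarrow> nat" where
  "point_degree \<F> x = card {F \<in> \<F>. x \<subseteq> F}"

definition subspace_degree ::
    "('f::field \<Rightarrow> 'v::ab_group_add \<Rightarrow> 'v) \<Rightarrow> 'v set set \<Rightarrow> 'v set \<Rightarrow> nat" where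
  "subspace_degree scale \<F> S = (\<Sum>x\<in>Gr scale 1 S. point_degree \<F> x)"

text \<open>
  Meaningful only if \<open>\<F>\<close> is a proper subset of \<open>Gr scale k V\<close> and the latter is finite;
  otherwise \<open>Min\<close> is applied to an empty or possibly infinite set.
\<close>

definition ore_degree ::
    "('f::field \<Rightarrow> 'v::ab_group_add \<Rightarrow> 'v) \<Rightarrow> 'v set \<Rightarrow> nat \<Rightarrow> 'v set set \<Rightarrow> nat" where
  "ore_degree scale V k \<F> = Min (subspace_degree scale \<F> ` (Gr scale k V - \<F>))"

text \<open>
  A matching of size \<open>s\<close> is an indexed family \<open>Fs 1, \<dots>, Fs s\<close>; values of \<open>Fs\<close> at other
  indices are irrelevant. The sum is the elementwise sum of sets, i.e. the sum of subspaces.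
\<close>

definition direct_sum_matching ::
    "('f::field \<Rightarrow> 'v::ab_group_add \<Rightarrow> 'v) \<Rightarrow> nat \<Rightarrow> 'v set set \<Rightarrow> nat \<Rightarrow> (nat \<Rightarrow> 'v set) \<Rightarrow> bool" where
  "direct_sum_matching scale k \<F> s Fs \<longleftrightarrow>
     (\<forall>j\<in>{1..s}. Fs j \<in> \<F>) \<and> vector_space.dim scale (\<Sum>j=1..s. Fs j) = s * k"

definition monochromatic :: "('v set \<Rightarrow> nat) \<Rightarrow> nat \<Rightarrow> nat \<Rightarrow> (nat \<Rightarrow> 'v set) \<Rightarrow> bool" where
  "monochromatic \<chi> i s Fs \<longleftrightarrow> (\<forall>j\<in>{1..s}. \<chi> (Fs j) = i)"

end

theory Submission imports Defs "HOL-Analysis.Convex" begin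

text \<open>
  A direct-sum matching of size \<open>M + 1\<close> in the whole family suffices: one colour then occurs at
  least \<open>a\<^sub>i\<close> times in it, and subfamilies of direct families are direct. Suppose there is none.
  Double counting with Cauchy--Schwarz, averaging the degree of \<open>S\<close> over all
  \<open>S \<notin> \<F>\<close>, shows that \<open>\<sigma> [n] \<le> [k]\<^sup>2 |\<F>|\<close>, where \<open>[m]\<close> is the number of points of an
  \<open>m\<close>-space.

  For \<open>M \<ge> 2\<close>, call a vector heavy if its degree exceeds the number of \<open>k\<close>-spaces through it that
  can meet a given \<open>Mk\<close>-space. Independent heavy vectors extend a partial matching greedily, so
  the heavy vectors span a space \<open>W\<close> of dimension at most \<open>M\<close>. If \<open>dim W = M\<close>, all members meet
  \<open>W\<close>, and any \<open>S\<close> disjoint from \<open>W\<close> has small degree. Otherwise all members meet a space of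
  dimension at most \<open>Mk\<close> whose vectors outside \<open>W\<close> are light, and \<open>\<F>\<close> is too small.

  For \<open>M = 1\<close> this is too weak when \<open>n\<close> is close to \<open>2k + 1\<close>. Split the indicator of \<open>\<F>\<close> as
  \<open>\<alpha> + p + g\<close> along the eigenspaces of the \<open>q\<close>-Kneser operator. The Ore condition bounds the norm of
  \<open>p\<close>, which carries the variance of the degrees, while intersection forces it to be large, since
  all later eigenvalues are at most a third of the second one in absolute value.
\<close>

section \<open>Counting subspaces over a finite field\<close>

text \<open>\<open>q\<close> is the field size as a real number, so that counts can be subtracted
  and divided freely. \<open>k\<close> is the dimension of the members of the family; its relation
  to \<open>n\<close> is assumed lemma by lemma.\<close>

locale finite_vector_space = finite_dimensional_vector_space scale Basis
  for scale :: "'f::{field,finite} \<Rightarrow> 'v::ab_group_add \<Rightarrow> 'v" (infixr \<open>*s\<close> 75)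
    and Basis :: "'v set" +
  fixes n k :: nat and q :: real
  assumes dim_UNIV_eq: "dim (UNIV :: 'v set) = n"
    and q_eq: "q = real CARD('f)"
begin

lemma q_ge_2: "q \<ge> 2"
proof -
  have "card {0, 1 :: 'f} \<le> CARD('f)" by (intro card_mono) auto
  thus ?thesis using q_eq by simp
qed

section \<open>Sizes and dimensions of subspaces\<close>

text \<open>Every vector of the larger span is \<open>c *s v + x\<close> for a unique scalar
  \<open>c\<close> and a unique \<open>x\<close> in the smaller span.\<close>

lemma card_span_insert:
  assumes "v \<notin> span B" "finite (span B)"
  shows "finite (span (insert v B)) \<and> card (span (insert v B)) = CARD('f) * card (span B)"
proof -
  let ?g = "\<lambda>(c, x). c *s v + x"
  have "inj_on ?g (UNIV \<times> span B)"
  proof (rule inj_onI, clarsimp)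
    fix c x d y assume x: "x \<in> span B" and y: "y \<in> span B" and eq: "c *s v + x = d *s v + y"
    have "(c - d) *s v = y - x" using eq by (simp add: algebra_simps)
    also have "\<dots> \<in> span B" using x y by (rule span_diff[rotated])
    finally have "(c - d) *s v \<in> span B" .
    hence "inverse (c - d) *s ((c - d) *s v) \<in> span B" by (rule span_scale)
    hence "c = d" using assms(1) by (cases "c = d") auto
    thus "c = d \<and> x = y" using eq by simp
  qed
  moreover have "?g ` (UNIV \<times> span B) = span (insert v B)"
  proof safe
    fix c x assume "x \<in> span B"
    thus "c *s v + x \<in> span (insert v B)"
      by (auto simp: span_breakdown_eq intro!: exI[of _ c])
  next
    fix y assume "y \<in> span (insert v B)"
    then obtain c where "y - c *s v \<in> span B" by (auto simp: span_breakdown_eq)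
    thus "y \<in> ?g ` (UNIV \<times> span B)" by (intro image_eqI[of _ _ "(c, y - c *s v)"]) auto
  qed
  ultimately have "bij_betw ?g (UNIV \<times> span B) (span (insert v B))" by (simp add: bij_betw_def)
  thus ?thesis using assms(2)
    by (metis bij_betw_finite bij_betw_same_card card_cartesian_product finite finite_cartesian_product)
qed

lemma card_span_independent:
  assumes "independent B"
  shows "finite (span B) \<and> card (span B) = CARD('f) ^ card B"
proof -
  have "finite B" using assms by (rule finiteI_independent)
  thus ?thesis using assms
  proof (induction B rule: finite_induct)
    case (insert v B)
    thus ?case using card_span_insert[of v B] by (auto simp: independent_insert)
  qed simp
qed

lemma finite_vectors: "finite (X :: 'v set)"
  using card_span_independent[OF independent_Basis] span_Basis finite_subset[of X UNIV] by simp

lemma finite_collection [simp]: "finite (\<A> :: 'v set set)"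
  using finite_subset[of \<A> "Pow UNIV"] finite_vectors[of UNIV] finite_Pow_iff[of "UNIV :: 'v set"]
  by blast

lemma card_subspace: "subspace U \<Longrightarrow> real (card U) = q ^ dim U"
  using card_span_independent basis_subspace_exists[of U] q_eq
  by (metis basis_card_eq_dim of_nat_power order_refl)

lemma span_id: "subspace S \<Longrightarrow> span S = S"
  by simp

lemma subspace_sum_eq_span: "subspace U \<Longrightarrow> subspace W \<Longrightarrow> U + W = span (U \<union> W)"
  by (auto simp: span_Un set_plus_def span_id)

lemma dim_span_Un:
  assumes "subspace U" "subspace W"
  shows "dim (span (U \<union> W)) + dim (U \<inter> W) = dim U + dim W"
proof -
  have "span (U \<union> W) = {x + y | x y. x \<in> U \<and> y \<in> W}" using assms by (simp add: span_Un span_id)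
  thus ?thesis using dim_sums_Int[OF assms] by simp
qed

lemma dim_span_Un_disjoint:
  assumes "subspace U" "subspace W" "U \<inter> W = {0}"
  shows "dim (span (U \<union> W)) = dim U + dim W"
  using dim_span_Un[OF assms(1,2)] assms(3) by simp

lemma mem_Gr: "S \<in> Gr scale j UNIV \<longleftrightarrow> subspace S \<and> dim S = j"
  by (simp add: Gr_def)

section \<open>The \<open>k\<close>-spaces through one subspace that avoid another\<close>

text \<open>Two special cases recur: \<open>S = {0}\<close> gives all \<open>k\<close>-spaces
  containing \<open>J\<close>, and \<open>J = {0}\<close> gives all \<open>k\<close>-spaces disjoint
  from \<open>S\<close>.\<close>

definition through :: "'v set \<Rightarrow> 'v set \<Rightarrow> 'v set set" where
  "through J S = {F \<in> Gr scale k UNIV. J \<subseteq> F \<and> F \<inter> S = {0}}"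

lemma through_span_insert: "through (span (insert v J)) S = {F \<in> through J S. v \<in> F}"
  if "subspace J"
proof -
  have "span (insert v J) \<subseteq> F \<longleftrightarrow> v \<in> F \<and> J \<subseteq> F" if "subspace F" for F
    using that span_minimal[of "insert v J" F] span_superset[of "insert v J"] by blast
  thus ?thesis by (auto simp: through_def mem_Gr)
qed

text \<open>Double counting of pairs of a space \<open>F\<close> and a vector \<open>v\<close> of
  \<open>F\<close> outside \<open>J\<close>: each \<open>F\<close> has
  \<open>q ^ k - q ^ dim J\<close> such vectors, none of them in \<open>span (J \<union> S)\<close>.
  The weight \<open>f\<close> is arbitrary because the recursion serves both for counting and for
  sums of functions on the \<open>k\<close>-spaces.\<close>

lemma sum_through_span_insert:
  fixes f :: "'v set \<Rightarrow> real"
  assumes J: "subspace J" and S: "subspace S"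
  shows "(\<Sum>v\<in>-span (J \<union> S). \<Sum>F\<in>through (span (insert v J)) S. f F) =
         (q ^ k - q ^ dim J) * (\<Sum>F\<in>through J S. f F)"
proof -
  have notin: "v \<notin> F" if v: "v \<in> span (J \<union> S)" "v \<notin> J" and F: "F \<in> through J S" for v F
  proof
    assume "v \<in> F"
    obtain x y where xy: "v = x + y" "x \<in> J" "y \<in> S"
      using v(1) J S unfolding span_Un by (auto simp: span_id)
    have sF: "subspace F" "J \<subseteq> F" "F \<inter> S = {0}" using F by (auto simp: through_def mem_Gr)
    have "y = v - x" using xy by simp
    also have "\<dots> \<in> F" using \<open>v \<in> F\<close> xy(2) sF by (intro subspace_diff) auto
    finally have "y = 0" using xy(3) sF(3) by blast
    thus False using xy v(2) by simp
  qed
  have "(\<Sum>v\<in>-span (J \<union> S). \<Sum>F\<in>through (span (insert v J)) S. f F) =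
        (\<Sum>v\<in>-J. \<Sum>F\<in>{F \<in> through J S. v \<in> F}. f F)"
  proof (rule sum.mono_neutral_cong_left)
    show "- span (J \<union> S) \<subseteq> - J" using span_superset[of "J \<union> S"] by blast
    show "\<forall>i\<in>- J - - span (J \<union> S). sum f {F \<in> through J S. i \<in> F} = 0"
      using notin by (auto intro!: sum.neutral)
  qed (simp_all add: through_span_insert[OF J] finite_vectors)
  also have "\<dots> = (\<Sum>v\<in>-J. \<Sum>F\<in>through J S. if v \<in> F then f F else 0)"
    by (intro sum.cong refl sum.inter_filter) simp
  also have "\<dots> = (\<Sum>F\<in>through J S. \<Sum>v\<in>-J. if v \<in> F then f F else 0)"
    by (rule sum.swap)
  also have "\<dots> = (\<Sum>F\<in>through J S. (q ^ k - q ^ dim J) * f F)"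
  proof (rule sum.cong[OF refl])
    fix F assume F: "F \<in> through J S"
    have "(\<Sum>v\<in>-J. if v \<in> F then f F else 0) = (\<Sum>v\<in>{v\<in>-J. v \<in> F}. f F)"
      by (rule sum.inter_filter[symmetric]) (rule finite_vectors)
    also have "{v\<in>-J. v \<in> F} = F - J" by auto
    also have "(\<Sum>v\<in>F - J. f F) = real (card (F - J)) * f F" by simp
    also have "real (card (F - J)) = real (card F) - real (card J)"
      using F finite_vectors by (subst card_Diff_subset) (auto simp: through_def of_nat_diff card_mono)
    also have "\<dots> = q ^ k - q ^ dim J"
      using F J by (auto simp: through_def mem_Gr card_subspace)
    finally show "(\<Sum>v\<in>-J. if v \<in> F then f F else 0) = (q ^ k - q ^ dim J) * f F" .
  qed
  finally show ?thesis by (simp add: sum_distrib_left)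
qed

text \<open>Builds up from a \<open>j\<close>-space one dimension at a time: at dimension
  \<open>i\<close> there are \<open>q ^ n - q ^ (i + s)\<close> vectors outside the span with the
  \<open>s\<close>-space to be avoided, and a given final \<open>k\<close>-space contains
  \<open>q ^ k - q ^ i\<close> admissible ones.\<close>

definition through_count :: "nat \<Rightarrow> nat \<Rightarrow> real" where
  "through_count s j = (\<Prod>i=j..<k. (q ^ n - q ^ (i + s)) / (q ^ k - q ^ i))"

lemma q_power_less: "i < j \<Longrightarrow> q ^ i < q ^ j"
  using q_ge_2 by (intro power_strict_increasing) auto

lemma q_power_le: "i \<le> j \<Longrightarrow> q ^ i \<le> q ^ j"
  using q_ge_2 by (intro power_increasing) auto

lemma through_count_Suc: "j < k \<Longrightarrow> through_count s j * (q ^ k - q ^ j) = (q ^ n - q ^ (j + s)) * through_count s (Suc j)"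
  using q_power_less[of j k] by (simp add: through_count_def prod.atLeast_Suc_lessThan)

lemma through_count_pos: "k + s \<le> n \<Longrightarrow> through_count s j > 0"
  unfolding through_count_def
  by (intro prod_pos) (auto intro!: divide_pos_pos simp: q_power_less)

text \<open>Induction on the missing dimension \<open>k - dim J\<close>, by the double count with
  constant weight: a vector outside \<open>span (J \<union> S)\<close> enlarges \<open>J\<close> to
  a space still disjoint from \<open>S\<close>.\<close>

lemma card_through:
  assumes "subspace J" "subspace S" "J \<inter> S = {0}" "dim J \<le> k"
  shows "real (card (through J S)) = through_count (dim S) (dim J)"
  using assms
proof (induction "k - dim J" arbitrary: J)
  case 0
  have "F = J" if "F \<in> through J S" for F
    using subspace_dim_equal[of J F] that 0 by (simp add: through_def mem_Gr)
  moreover have "J \<in> through J S" using 0 by (simp add: through_def mem_Gr)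
  ultimately have "through J S = {J}" by blast
  thus ?case using 0 by (simp add: through_count_def)
next
  case (Suc d J)
  hence jk: "dim J < k" by simp
  have "(q ^ k - q ^ dim J) * real (card (through J S)) =
        (\<Sum>v\<in>-span (J \<union> S). real (card (through (span (insert v J)) S)))"
    using sum_through_span_insert[OF Suc.prems(1,2), of "\<lambda>_. 1"] by simp
  also have "\<dots> = (\<Sum>v\<in>-span (J \<union> S). through_count (dim S) (Suc (dim J)))"
  proof (rule sum.cong[OF refl])
    fix v assume v: "v \<in> -span (J \<union> S)"
    have vJ: "v \<notin> span J" using v span_mono[of J "J \<union> S"] by auto
    have d: "dim (span (insert v J)) = Suc (dim J)" using vJ by (simp add: dim_insert)
    have "span (insert v J) \<inter> S \<subseteq> {0}"
    proof
      fix y assume y: "y \<in> span (insert v J) \<inter> S"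
      then obtain c where c: "y - c *s v \<in> J"
        using span_id[OF Suc.prems(1)] by (auto simp: span_breakdown_eq)
      have "y - (y - c *s v) \<in> span (J \<union> S)"
        using y c by (intro span_diff span_base) auto
      hence "c *s v \<in> span (J \<union> S)" by simp
      hence "inverse c *s (c *s v) \<in> span (J \<union> S)" by (rule span_scale)
      hence "c = 0" using v by (cases "c = 0") auto
      thus "y \<in> {0}" using c y Suc.prems(3) by auto
    qed
    hence "span (insert v J) \<inter> S = {0}" using Suc.prems(2) by (auto simp: span_zero subspace_0)
    thus "real (card (through (span (insert v J)) S)) = through_count (dim S) (Suc (dim J))"
      using Suc.hyps(1)[of "span (insert v J)"] Suc.hyps(2) Suc.prems(2) jk d by simp
  qed
  also have "\<dots> = real (card (-span (J \<union> S))) * through_count (dim S) (Suc (dim J))" by simp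
  also have "real (card (-span (J \<union> S))) = q ^ n - q ^ (dim J + dim S)"
  proof -
    have "real (card (UNIV - span (J \<union> S))) = real (card (UNIV :: 'v set)) - real (card (span (J \<union> S)))"
      using finite_vectors by (subst card_Diff_subset) (auto simp: of_nat_diff card_mono)
    thus ?thesis using dim_span_Un_disjoint[OF Suc.prems(1,2,3)] card_subspace[of UNIV] card_subspace[of "span (J \<union> S)"]
      dim_UNIV_eq by (simp add: Compl_eq_Diff_UNIV)
  qed
  also have "\<dots> * through_count (dim S) (Suc (dim J)) = through_count (dim S) (dim J) * (q ^ k - q ^ dim J)"
    using through_count_Suc[OF jk] by simp
  finally show ?case using q_power_less[OF jk] by simp
qed

text \<open>Taking \<open>q ^ (i + j + s)\<close> out of each numerator and
  \<open>q ^ (i + j)\<close> out of each denominator leaves \<open>q ^ s\<close> times a factor of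
  the Gaussian coefficient. With \<open>j = 1\<close> and \<open>s\<close> equal to \<open>0\<close>
  or \<open>M\<close>, this identifies the two terms of the Ore hypothesis.\<close>

lemma through_count_gauss:
  assumes "k + s \<le> n" "j \<le> k"
  shows "through_count s j = q ^ (s * (k - j)) * gauss_binomial CARD('f) (n - s - j) (k - j)"
proof -
  have "through_count s j = (\<Prod>i<k - j. (q ^ n - q ^ (i + j + s)) / (q ^ k - q ^ (i + j)))"
    unfolding through_count_def using assms
    by (intro prod.reindex_bij_witness[of _ "\<lambda>i. i + j" "\<lambda>i. i - j"]) auto
  also have "\<dots> = (\<Prod>i<k - j. q ^ s * ((q ^ (n - s - j - i) - 1) / (q ^ (k - j - i) - 1)))"
  proof (rule prod.cong[OF refl])
    fix i assume i: "i \<in> {..<k - j}"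
    have e: "q ^ n = q ^ (i + j + s) * q ^ (n - s - j - i)" "q ^ k = q ^ (i + j) * q ^ (k - j - i)"
      using i assms by (simp_all flip: power_add)
    have "q ^ n - q ^ (i + j + s) = q ^ (i + j) * (q ^ s * (q ^ (n - s - j - i) - 1))"
      unfolding e by (simp add: algebra_simps power_add)
    moreover have "q ^ k - q ^ (i + j) = q ^ (i + j) * (q ^ (k - j - i) - 1)"
      unfolding e by (simp add: algebra_simps)
    ultimately show "(q ^ n - q ^ (i + j + s)) / (q ^ k - q ^ (i + j)) =
      q ^ s * ((q ^ (n - s - j - i) - 1) / (q ^ (k - j - i) - 1))"
      using q_ge_2 by simp
  qed
  also have "\<dots> = q ^ (s * (k - j)) * gauss_binomial CARD('f) (n - s - j) (k - j)"
  proof -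
    have "k - j \<le> n - s - j" using assms by simp
    thus ?thesis unfolding gauss_binomial_def prod.distrib by (simp add: power_mult flip: q_eq)
  qed
  finally show ?thesis .
qed

lemma span_singleton_subset_iff: "subspace F \<Longrightarrow> span {v} \<subseteq> F \<longleftrightarrow> v \<in> F"
  using span_minimal[of "{v}" F] span_superset[of "{v}"] by blast

lemma span_singleton_mem: "x \<in> span {v} \<Longrightarrow> subspace F \<Longrightarrow> v \<in> F \<Longrightarrow> x \<in> F"
  using span_singleton_subset_iff by blast

lemma span_singleton_Int:
  assumes "subspace F"
  shows "v \<notin> F \<Longrightarrow> span {v} \<inter> F = {0}"
proof -
  assume v: "v \<notin> F"
  have "x = 0" if "x \<in> span {v}" "x \<in> F" for x
  proof -
    obtain c where c: "x = c *s v" using \<open>x \<in> span {v}\<close> by (auto simp: span_singleton)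
    have "c \<noteq> 0 \<Longrightarrow> v \<in> F"
      using subspace_scale[OF assms \<open>x \<in> F\<close>, of "inverse c"] c by simp
    thus "x = 0" using v c by auto
  qed
  thus "span {v} \<inter> F = {0}" using assms by (auto simp: span_zero subspace_0)
qed

section \<open>Points replaced with nonzero vectors, and degrees\<close>

text \<open>A point contains \<open>q - 1\<close> nonzero vectors, and each of them spans
  it.\<close>

lemma sum_points:
  fixes g :: "'v set \<Rightarrow> real"
  assumes "subspace S"
  shows "(\<Sum>v\<in>S - {0}. g (span {v})) = (q - 1) * (\<Sum>x\<in>Gr scale 1 S. g x)"
proof -
  have "(\<lambda>v. span {v}) ` (S - {0}) \<subseteq> Gr scale 1 S"
    using assms by (auto simp: Gr_def dest: span_singleton_mem)
  hence "(\<Sum>v\<in>S - {0}. g (span {v})) =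
        (\<Sum>x\<in>Gr scale 1 S. \<Sum>v\<in>{v\<in>S - {0}. span {v} = x}. g (span {v}))"
    by (intro sum.group[symmetric]) (auto simp: finite_vectors)
  also have "\<dots> = (\<Sum>x\<in>Gr scale 1 S. (q - 1) * g x)"
  proof (rule sum.cong[OF refl])
    fix x assume x: "x \<in> Gr scale 1 S"
    hence xs: "subspace x" "x \<subseteq> S" "dim x = 1" by (auto simp: Gr_def)
    have "span {v} = x" if v: "v \<in> x" "v \<noteq> 0" for v
    proof -
      have sub: "span {v} \<subseteq> x" using v xs by (simp add: span_singleton_subset_iff)
      show ?thesis using subspace_dim_equal[OF _ xs(1) sub] v xs by simp
    qed
    moreover have "v \<in> span {v}" for v by (simp add: span_base)
    ultimately have eq: "{v\<in>S - {0}. span {v} = x} = x - {0}" using xs(2) by blast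
    have "real (card (x - {0})) = real (card x) - 1"
      using subspace_0[OF xs(1)] finite_vectors[of x] card_gt_0_iff[of x]
      by (auto simp: card_Diff_singleton of_nat_diff Suc_le_eq)
    also have "\<dots> = q - 1" using card_subspace[OF xs(1)] xs by simp
    finally have "real (card (x - {0})) = q - 1" .
    thus "(\<Sum>v\<in>{v\<in>S - {0}. span {v} = x}. g (span {v})) = (q - 1) * g x"
    proof -
      have "(\<Sum>v\<in>{v\<in>S - {0}. span {v} = x}. g (span {v})) = (\<Sum>v\<in>{v\<in>S - {0}. span {v} = x}. g x)"
        by (rule sum.cong) auto
      also have "\<dots> = real (card (x - {0})) * g x" unfolding eq by simp
      finally show ?thesis using \<open>real (card (x - {0})) = q - 1\<close> by simp
    qed
  qed
  finally show ?thesis by (simp add: sum_distrib_left)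
qed

text \<open>For a family of subspaces and \<open>v \<noteq> 0\<close> this is the degree of the
  point \<open>span {v}\<close>; indexing by vectors avoids sums over points.\<close>

definition deg :: "'v set set \<Rightarrow> 'v \<Rightarrow> real" where
  "deg \<A> v = real (card {F \<in> \<A>. v \<in> F})"

lemma deg_mono: "\<A> \<subseteq> \<B> \<Longrightarrow> deg \<A> v \<le> deg \<B> v"
  unfolding deg_def by (intro of_nat_mono card_mono) auto

lemma subspace_degree_eq:
  assumes "\<A> \<subseteq> Gr scale k UNIV" "subspace S"
  shows "(q - 1) * real (subspace_degree scale \<A> S) = (\<Sum>v\<in>S - {0}. deg \<A> v)"
proof -
  have "(\<Sum>v\<in>S - {0}. deg \<A> v) = (\<Sum>v\<in>S - {0}. real (point_degree \<A> (span {v})))"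
    using assms(1) unfolding deg_def point_degree_def
    by (intro sum.cong refl arg_cong[where f = real] arg_cong[where f = card])
       (use span_singleton_subset_iff mem_Gr in blast)
  thus ?thesis using sum_points[OF assms(2), of "\<lambda>x. real (point_degree \<A> x)"] by (simp add: subspace_degree_def)
qed

text \<open>The Ore condition enters the argument only in this form. The factor \<open>q - 1\<close>
  accounts for summing over nonzero vectors.\<close>

lemma ore_degree_le:
  assumes "\<A> \<subseteq> Gr scale k UNIV" "S \<in> Gr scale k UNIV - \<A>"
  shows "(q - 1) * real (ore_degree scale UNIV k \<A>) \<le> (\<Sum>v\<in>S - {0}. deg \<A> v)"
proof -
  have "ore_degree scale UNIV k \<A> \<le> subspace_degree scale \<A> S"
    unfolding ore_degree_def using assms(2) by (intro Min_le) auto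
  hence "(q - 1) * real (ore_degree scale UNIV k \<A>) \<le> (q - 1) * real (subspace_degree scale \<A> S)"
    using q_ge_2 by (intro mult_left_mono) auto
  also have "\<dots> = (\<Sum>v\<in>S - {0}. deg \<A> v)"
    using assms by (intro subspace_degree_eq) (auto simp: mem_Gr)
  finally show ?thesis .
qed

lemma card_nonzero: "subspace S \<Longrightarrow> real (card (S - {0})) = q ^ dim S - 1"
  using subspace_0[of S] finite_vectors[of S] card_gt_0_iff[of S] card_subspace[of S]
  by (auto simp: card_Diff_singleton of_nat_diff Suc_le_eq)

text \<open>Exchange of summation over incident pairs; \<open>f = 1\<close> yields the first moment
  of the degrees and \<open>f = deg \<A>\<close> the second.\<close>

lemma sum_members_vectors:
  fixes f :: "'v \<Rightarrow> real"
  shows "(\<Sum>F\<in>\<A>. \<Sum>v\<in>F \<inter> Z. f v) = (\<Sum>v\<in>Z. f v * deg \<A> v)"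
proof -
  have "(\<Sum>F\<in>\<A>. \<Sum>v\<in>F \<inter> Z. f v) = (\<Sum>F\<in>\<A>. \<Sum>v\<in>Z. if v \<in> F then f v else 0)"
    by (rule sum.cong[OF refl], subst Int_commute) (rule sum.inter_restrict[OF finite_vectors])
  also have "\<dots> = (\<Sum>v\<in>Z. \<Sum>F\<in>\<A>. if v \<in> F then f v else 0)" by (rule sum.swap)
  also have "\<dots> = (\<Sum>v\<in>Z. \<Sum>F\<in>{F\<in>\<A>. v \<in> F}. f v)"
    by (rule sum.cong[OF refl], rule sum.inter_filter[symmetric]) simp
  finally show ?thesis by (simp add: deg_def mult.commute)
qed

lemma sum_deg:
  assumes "\<A> \<subseteq> Gr scale k UNIV"
  shows "(\<Sum>v\<in>-{0}. deg \<A> v) = real (card \<A>) * (q ^ k - 1)"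
proof -
  have "(\<Sum>v\<in>-{0}. deg \<A> v) = (\<Sum>F\<in>\<A>. \<Sum>v\<in>F \<inter> -{0}. 1)"
    unfolding sum_members_vectors by simp
  also have "\<dots> = (\<Sum>F\<in>\<A>. q ^ k - 1)"
    using assms by (intro sum.cong) (auto simp: card_nonzero mem_Gr simp flip: Diff_eq)
  finally show ?thesis by simp
qed

lemma through_trivial: "through J {0} = {F \<in> Gr scale k UNIV. J \<subseteq> F}"
  by (auto simp: through_def mem_Gr subspace_0)

lemma card_Gr: "real (card (Gr scale k UNIV)) = through_count 0 0"
proof -
  have "through {0} {0} = Gr scale k UNIV" unfolding through_trivial by (auto simp: mem_Gr subspace_0)
  thus ?thesis using card_through[of "{0}" "{0}"] by simp
qed

lemma card_containing:
  assumes "subspace J" "dim J \<le> k"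
  shows "real (card {F \<in> Gr scale k UNIV. J \<subseteq> F}) = through_count 0 (dim J)"
  using card_through[of J "{0}"] assms by (auto simp: through_trivial subspace_0)

lemma deg_Gr:
  assumes "v \<noteq> 0" "1 \<le> k"
  shows "deg (Gr scale k UNIV) v = through_count 0 1"
proof -
  have "{F \<in> Gr scale k UNIV. v \<in> F} = {F \<in> Gr scale k UNIV. span {v} \<subseteq> F}"
    using span_singleton_subset_iff mem_Gr by blast
  thus ?thesis using card_containing[of "span {v}"] assms by (simp add: deg_def)
qed

lemma card_containing_2:
  assumes "v \<noteq> 0" "u \<notin> span {v}" "2 \<le> k"
  shows "real (card {F \<in> Gr scale k UNIV. v \<in> F \<and> u \<in> F}) = through_count 0 2"
proof -
  have "span {u, v} \<subseteq> F \<longleftrightarrow> v \<in> F \<and> u \<in> F" if "subspace F" for F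
    using that span_minimal[of "{u, v}" F] span_superset[of "{u, v}"] by blast
  hence "{F \<in> Gr scale k UNIV. v \<in> F \<and> u \<in> F} = {F \<in> Gr scale k UNIV. span {u, v} \<subseteq> F}"
    by (auto simp: mem_Gr)
  moreover have "dim {u, v} = 2" using assms by (simp add: dim_insert)
  ultimately show ?thesis using card_containing[of "span {u, v}"] assms by simp
qed

lemma card_Gr_mult: "1 \<le> k \<Longrightarrow> through_count 0 0 * (q ^ k - 1) = (q ^ n - 1) * through_count 0 1"
  using through_count_Suc[of 0 0] by simp

lemma through_count_0_2: "2 \<le> k \<Longrightarrow> 2 \<le> n \<Longrightarrow> through_count 0 2 = through_count 0 1 * (q ^ k - q) / (q ^ n - q)"
  using through_count_Suc[of 1 0] q_power_less[of 1 n] by (simp add: numeral_2_eq_2 field_simps)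

section \<open>Averaging the Ore condition\<close>

text \<open>Sums the assumed bound over all \<open>S\<close> outside \<open>\<A>\<close>. Over all
  \<open>k\<close>-spaces the degree sums are known, since each nonzero vector lies in
  \<open>through_count 0 1\<close> of them; the part coming from members of \<open>\<A>\<close> is
  the second moment of the degrees.\<close>

lemma sum_deg_sq_bound:
  assumes \<A>: "\<A> \<subseteq> Gr scale k UNIV" and k: "1 \<le> k"
    and \<sigma>: "\<And>S. S \<in> Gr scale k UNIV - \<A> \<Longrightarrow> \<sigma> \<le> (\<Sum>v\<in>S - {0}. deg \<A> v)"
  shows "\<sigma> * (through_count 0 0 - real (card \<A>)) \<le> through_count 0 1 * (q ^ k - 1) * real (card \<A>) - (\<Sum>v\<in>-{0}. (deg \<A> v)\<^sup>2)"
proof -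
  let ?G = "Gr scale k UNIV"
  have "real (card (?G - \<A>)) = through_count 0 0 - real (card \<A>)"
    using \<A> card_Gr by (subst card_Diff_subset) (auto simp: card_mono)
  hence "\<sigma> * (through_count 0 0 - real (card \<A>)) = (\<Sum>S\<in>?G - \<A>. \<sigma>)" by simp
  also have "\<dots> \<le> (\<Sum>S\<in>?G - \<A>. \<Sum>v\<in>S - {0}. deg \<A> v)" using \<sigma> by (intro sum_mono)
  also have "\<dots> = (\<Sum>S\<in>?G. \<Sum>v\<in>S \<inter> -{0}. deg \<A> v) - (\<Sum>S\<in>\<A>. \<Sum>v\<in>S \<inter> -{0}. deg \<A> v)"
    using \<A> by (simp add: sum_diff Diff_eq[of _ "{0}"])
  also have "(\<Sum>S\<in>?G. \<Sum>v\<in>S \<inter> -{0}. deg \<A> v) = (\<Sum>v\<in>-{0}. deg \<A> v) * through_count 0 1"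
    unfolding sum_members_vectors sum_distrib_right using k by (intro sum.cong) (auto simp: deg_Gr)
  also have "(\<Sum>S\<in>\<A>. \<Sum>v\<in>S \<inter> -{0}. deg \<A> v) = (\<Sum>v\<in>-{0}. (deg \<A> v)\<^sup>2)"
    unfolding sum_members_vectors by (simp add: power2_eq_square)
  finally show ?thesis using sum_deg[OF \<A>] by (simp add: algebra_simps)
qed

text \<open>Cauchy--Schwarz bounds the second moment below by the squared total degree over
  \<open>q ^ n - 1\<close>. Then both sides carry the factor \<open>through_count 0 0 - a\<close>,
  which is positive because \<open>\<A>\<close> is a proper subfamily.\<close>

lemma ore_averaging:
  assumes \<A>: "\<A> \<subset> Gr scale k UNIV" and k: "1 \<le> k" "k \<le> n"
    and \<sigma>: "\<And>S. S \<in> Gr scale k UNIV - \<A> \<Longrightarrow> \<sigma> \<le> (\<Sum>v\<in>S - {0}. deg \<A> v)"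
  shows "\<sigma> * (q ^ n - 1) \<le> (q ^ k - 1)\<^sup>2 * real (card \<A>)"
proof -
  define a where "a = real (card \<A>)"
  have a: "a < through_count 0 0" using psubset_card_mono[OF _ \<A>] by (simp add: a_def flip: card_Gr)
  have qn: "q ^ n - 1 > 0" using q_power_less[of 0 n] k by simp
  have cs: "(\<Sum>v\<in>-{0 :: 'v}. deg \<A> v)\<^sup>2 \<le> (\<Sum>v\<in>-{0}. (deg \<A> v)\<^sup>2) * (q ^ n - 1)"
  proof -
    have "(\<Sum>v\<in>-{0 :: 'v}. deg \<A> v * 1)\<^sup>2 \<le> (\<Sum>v\<in>-{0}. (deg \<A> v)\<^sup>2) * (\<Sum>v\<in>-{0 :: 'v}. 1\<^sup>2)"
      by (rule Cauchy_Schwarz_ineq_sum)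
    thus ?thesis using card_nonzero[of UNIV] dim_UNIV_eq by (simp add: Compl_eq_Diff_UNIV)
  qed
  have "\<sigma> * (through_count 0 0 - a) * (q ^ n - 1) \<le>
      (through_count 0 1 * (q ^ k - 1) * a - (\<Sum>v\<in>-{0}. (deg \<A> v)\<^sup>2)) * (q ^ n - 1)"
    using sum_deg_sq_bound[OF psubset_imp_subset[OF \<A>] k(1) \<sigma>] qn
    unfolding a_def by (intro mult_right_mono) auto
  also have "\<dots> \<le> ((q ^ n - 1) * through_count 0 1) * (q ^ k - 1) * a - (a * (q ^ k - 1))\<^sup>2"
  proof -
    have "(x * K * a - D) * A \<le> (A * x) * K * a - (a * K)\<^sup>2" if "(a * K)\<^sup>2 \<le> D * A" for x K D A :: real
      using that unfolding left_diff_distrib by (simp add: mult_ac)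
    thus ?thesis using cs sum_deg[OF psubset_imp_subset[OF \<A>]] unfolding a_def by metis
  qed
  also have "(q ^ n - 1) * through_count 0 1 = through_count 0 0 * (q ^ k - 1)" using card_Gr_mult k by simp
  also have "through_count 0 0 * (q ^ k - 1) * (q ^ k - 1) * a - (a * (q ^ k - 1))\<^sup>2 = (q ^ k - 1)\<^sup>2 * a * (through_count 0 0 - a)"
    by algebra
  finally have "\<sigma> * (q ^ n - 1) * (through_count 0 0 - a) \<le> (q ^ k - 1)\<^sup>2 * a * (through_count 0 0 - a)"
    by (simp only: mult_ac)
  thus ?thesis using a by (simp add: a_def)
qed

end

section \<open>Greedy matchings\<close>

text \<open>A Weierstrass-type product inequality; the induction step is
  \<open>(1 - x) * (1 + x + T) \<le> 1 + T\<close> for nonnegative \<open>x\<close> and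
  \<open>T\<close>.\<close>

lemma prod_one_minus_le:
  fixes x :: "'i \<Rightarrow> real"
  assumes "finite I" "\<And>i. i \<in> I \<Longrightarrow> 0 \<le> x i \<and> x i \<le> 1"
  shows "(\<Prod>i\<in>I. 1 - x i) * (1 + (\<Sum>i\<in>I. x i)) \<le> 1"
  using assms
proof (induction I rule: finite_induct)
  case (insert i I)
  have S: "(\<Sum>i\<in>I. x i) \<ge> 0" and x: "0 \<le> x i" using insert by (auto intro!: sum_nonneg)
  have "(1 - x i) * (1 + (x i + (\<Sum>i\<in>I. x i))) = 1 + (\<Sum>i\<in>I. x i) - x i * (\<Sum>i\<in>I. x i) - x i * x i"
    by algebra
  also have "\<dots> \<le> 1 + (\<Sum>i\<in>I. x i)"
    using mult_nonneg_nonneg[OF x S] mult_nonneg_nonneg[OF x x] by linarith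
  finally have "(\<Prod>i\<in>I. 1 - x i) * ((1 - x i) * (1 + (x i + (\<Sum>i\<in>I. x i)))) \<le>
      (\<Prod>i\<in>I. 1 - x i) * (1 + (\<Sum>i\<in>I. x i))"
    using insert by (intro mult_left_mono prod_nonneg) auto
  also have "\<dots> \<le> 1" using insert by auto
  finally show ?case using insert by (simp add: mult_ac)
qed simp

context finite_vector_space
begin

section \<open>Partial matchings and their extension\<close>

text \<open>Only the sum \<open>U\<close> is exposed, because whether a further member extends the
  matching depends on \<open>U\<close> alone.\<close>

definition matching :: "'v set set \<Rightarrow> nat \<Rightarrow> 'v set \<Rightarrow> bool" where
  "matching \<A> l U \<longleftrightarrow> (\<exists>Fs. (\<forall>j\<in>{1..l}. Fs j \<in> \<A>) \<and> U = (\<Sum>j=1..l. Fs j) \<and> dim U = l * k)"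

lemma subspace_sum_family:
  assumes "finite I" "\<And>j. j \<in> I \<Longrightarrow> subspace (Fs j)"
  shows "subspace (\<Sum>j\<in>I. Fs j)"
  using assms by (induction I rule: finite_induct) (auto simp: subspace_sum_eq_span set_zero)

lemma matching_subspace:
  assumes "matching \<A> l U" "\<A> \<subseteq> Gr scale k UNIV"
  shows "subspace U" "dim U = l * k"
  using assms by (auto simp: matching_def mem_Gr subset_iff intro!: subspace_sum_family)

lemma matching_0: "matching \<A> 0 {0}"
  by (auto simp: matching_def set_zero)

lemma matching_Suc:
  assumes m: "matching \<A> l U" and \<A>: "\<A> \<subseteq> Gr scale k UNIV" and F: "F \<in> \<A>" "F \<inter> U = {0}"
  shows "matching \<A> (Suc l) (span (U \<union> F))"
proof -
  obtain Fs where Fs: "\<forall>j\<in>{1..l}. Fs j \<in> \<A>" "U = (\<Sum>j=1..l. Fs j)"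
    using m by (auto simp: matching_def)
  have U: "subspace U" "dim U = l * k" using matching_subspace[OF m \<A>] .
  have sF: "subspace F" "dim F = k" using F \<A> by (auto simp: mem_Gr)
  have "span (U \<union> F) = U + F" using U sF by (simp add: subspace_sum_eq_span)
  also have "\<dots> = (\<Sum>j=1..Suc l. (Fs(Suc l := F)) j)" using Fs(2) by simp
  finally have "span (U \<union> F) = (\<Sum>j=1..Suc l. (Fs(Suc l := F)) j)" .
  moreover have "dim (span (U \<union> F)) = Suc l * k"
    using dim_span_Un_disjoint[OF U(1) sF(1)] U sF F(2) by (simp add: Int_commute)
  moreover have "\<forall>j\<in>{1..Suc l}. (Fs(Suc l := F)) j \<in> \<A>" using Fs(1) F by auto
  ultimately show ?thesis unfolding matching_def by blast
qed

text \<open>Each such \<open>F\<close> contains at least \<open>q - 1\<close> nonzero vectors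
  \<open>u\<close> of \<open>Z\<close>. As \<open>v\<close> is not in \<open>Z\<close>, every such
  \<open>u\<close> is independent of \<open>v\<close>, and the two lie together in
  \<open>through_count 0 2\<close> of the \<open>k\<close>-spaces.\<close>

lemma card_meeting_le:
  assumes Z: "subspace Z" "v \<notin> Z" and k: "2 \<le> k"
  shows "(q - 1) * real (card {F \<in> Gr scale k UNIV. v \<in> F \<and> F \<inter> Z \<noteq> {0}}) \<le> (q ^ dim Z - 1) * through_count 0 2"
proof -
  let ?X = "{F \<in> Gr scale k UNIV. v \<in> F \<and> F \<inter> Z \<noteq> {0}}"
  have "(q - 1) * real (card ?X) = (\<Sum>F\<in>?X. q - 1)" by simp
  also have "\<dots> \<le> (\<Sum>F\<in>?X. \<Sum>u\<in>F \<inter> (Z - {0}). 1)"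
  proof (rule sum_mono)
    fix F assume F: "F \<in> ?X"
    hence s: "subspace (F \<inter> Z)" using Z by (auto simp: mem_Gr intro: subspace_inter)
    have "dim (F \<inter> Z) \<noteq> 0" using F subspace_0[OF s] by auto
    hence "q ^ 1 \<le> q ^ dim (F \<inter> Z)" by (intro q_power_le) linarith
    also have "q ^ dim (F \<inter> Z) - 1 = real (card (F \<inter> (Z - {0})))"
      using card_nonzero[OF s] by (simp add: Int_Diff)
    finally show "q - 1 \<le> (\<Sum>u\<in>F \<inter> (Z - {0}). 1)" by simp
  qed
  also have "\<dots> = (\<Sum>u\<in>Z - {0}. deg ?X u)" unfolding sum_members_vectors by simp
  also have "\<dots> \<le> (\<Sum>u\<in>Z - {0}. through_count 0 2)"
  proof (rule sum_mono)
    fix u assume u: "u \<in> Z - {0}"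
    hence "u \<notin> span {v}" using span_singleton_Int[OF Z] by blast
    moreover have "v \<noteq> 0" using Z subspace_0 by auto
    moreover have "deg ?X u \<le> real (card {F \<in> Gr scale k UNIV. v \<in> F \<and> u \<in> F})"
      unfolding deg_def by (intro of_nat_mono card_mono) auto
    ultimately show "deg ?X u \<le> through_count 0 2" using card_containing_2[of v u] k by simp
  qed
  also have "\<dots> = (q ^ dim Z - 1) * through_count 0 2" using card_nonzero[OF Z(1)] by simp
  finally show ?thesis .
qed

text \<open>The degree of \<open>v\<close> exceeds the bound on the number of
  \<open>k\<close>-spaces through \<open>v\<close> that meet \<open>Z\<close>.\<close>

lemma heavy_member:
  assumes "\<A> \<subseteq> Gr scale k UNIV" "subspace Z" "v \<notin> Z" "2 \<le> k"
    and "(q ^ dim Z - 1) * through_count 0 2 < (q - 1) * deg \<A> v"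
  obtains F where "F \<in> \<A>" "v \<in> F" "F \<inter> Z = {0}"
proof (rule ccontr)
  assume "\<not> thesis"
  hence "{F \<in> \<A>. v \<in> F} \<subseteq> {F \<in> Gr scale k UNIV. v \<in> F \<and> F \<inter> Z \<noteq> {0}}"
    using assms(1) that by blast
  hence "deg \<A> v \<le> real (card {F \<in> Gr scale k UNIV. v \<in> F \<and> F \<inter> Z \<noteq> {0}})"
    unfolding deg_def by (intro of_nat_mono card_mono) auto
  hence "(q - 1) * deg \<A> v \<le> (q - 1) * real (card {F \<in> Gr scale k UNIV. v \<in> F \<and> F \<inter> Z \<noteq> {0}})"
    using q_ge_2 by (intro mult_left_mono) auto
  thus False using card_meeting_le[OF assms(2,3,4)] assms(5) by linarith
qed

lemma dim_Un_le_card: "finite B \<Longrightarrow> dim (U \<union> B) \<le> dim U + card B"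
  by (induction B rule: finite_induct) (auto simp: dim_insert)

text \<open>Exchanges the heavy vectors for members one at a time. The member \<open>F\<close>
  through \<open>b\<close> is chosen disjoint from the span \<open>?Z\<close> of the matching and
  the other heavy vectors, so these stay independent modulo the enlarged matching. The invariant
  \<open>l + card B = Suc M\<close> keeps \<open>dim ?Z\<close> at most \<open>M * k\<close>, which
  is what the threshold allows.\<close>

lemma matching_from_heavy:
  assumes \<A>: "\<A> \<subseteq> Gr scale k UNIV" and k: "2 \<le> k"
    and "matching \<A> l U" "finite B" "dim (U \<union> B) = l * k + card B" "l + card B = Suc M"
    and "\<And>b. b \<in> B \<Longrightarrow> (q ^ (M * k) - 1) * through_count 0 2 < (q - 1) * deg \<A> b"
    and c: "through_count 0 2 \<ge> 0"
  shows "\<exists>U. matching \<A> (Suc M) U"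
  using assms(3-7)
proof (induction "card B" arbitrary: l U B)
  case 0
  thus ?case by auto
next
  case (Suc m B l U)
  then obtain b where b: "b \<in> B" by fastforce
  define B' where "B' = B - {b}"
  have B': "finite B'" "card B' = m" "insert b (U \<union> B') = U \<union> B"
    using b Suc.hyps(2) Suc.prems(2) by (auto simp: B'_def)
  have U: "subspace U" "dim U = l * k" using matching_subspace[OF Suc.prems(1) \<A>] .
  let ?Z = "span (U \<union> B')"
  have le: "dim (U \<union> B') \<le> l * k + m" using dim_Un_le_card[of B' U] B' U by simp
  have "dim (insert b (U \<union> B')) = l * k + Suc m"
    using B'(3) Suc.prems(3) Suc.hyps(2) by simp
  hence bZ: "b \<notin> ?Z" and dZ: "dim ?Z = l * k + m"
    using le by (auto simp: dim_insert split: if_splits)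
  have lm: "l + m = M" using Suc.prems(4) Suc.hyps(2) by simp
  have "m \<le> m * k" using k by simp
  hence "l * k + m \<le> l * k + m * k" by simp
  also have "\<dots> = M * k" by (simp add: add_mult_distrib flip: lm)
  finally have "l * k + m \<le> M * k" .
  hence "(q ^ dim ?Z - 1) * through_count 0 2 \<le> (q ^ (M * k) - 1) * through_count 0 2"
    unfolding dZ using c by (intro mult_right_mono diff_right_mono q_power_le)
  hence "(q ^ dim ?Z - 1) * through_count 0 2 < (q - 1) * deg \<A> b" using Suc.prems(5)[OF b] by linarith
  then obtain F where F: "F \<in> \<A>" "b \<in> F" "F \<inter> ?Z = {0}"
    using heavy_member[OF \<A> subspace_span bZ k] by blast
  have sF: "subspace F" "dim F = k" using F \<A> by (auto simp: mem_Gr)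
  have "F \<inter> U = {0}" using F(3) span_superset[of "U \<union> B'"] subspace_0[OF U(1)] subspace_0[OF sF(1)] by auto
  hence m2: "matching \<A> (Suc l) (span (U \<union> F))" using matching_Suc[OF Suc.prems(1) \<A> F(1)] by simp
  have "dim (span (U \<union> F) \<union> B') = Suc l * k + card B'"
  proof (rule antisym)
    show "dim (span (U \<union> F) \<union> B') \<le> Suc l * k + card B'"
      using dim_Un_le_card[OF B'(1), of "span (U \<union> F)"] matching_subspace[OF m2 \<A>] by simp
    have "?Z \<union> F \<subseteq> span (span (U \<union> F) \<union> B')"
      using span_mono[of "U \<union> B'" "span (U \<union> F) \<union> B'"] span_superset[of "U \<union> F"]
        span_superset[of "span (U \<union> F) \<union> B'"] by blast
    hence "dim (span (?Z \<union> F)) \<le> dim (span (U \<union> F) \<union> B')"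
      by (metis dim_mono dim_span)
    moreover have "dim (span (?Z \<union> F)) = l * k + m + k"
      using dim_span_Un_disjoint[OF subspace_span sF(1)] F(3) dZ sF by (simp add: Int_commute)
    ultimately show "Suc l * k + card B' \<le> dim (span (U \<union> F) \<union> B')" using B' by simp
  qed
  thus ?case
    using Suc.hyps(1)[OF B'(2)[symmetric] m2 B'(1)] Suc.prems(4,5) B'(2) Suc.hyps(2)
    by (simp add: B'_def)
qed

text \<open>The members through \<open>v\<close> are among the \<open>k\<close>-spaces through
  \<open>v\<close> that are not disjoint from \<open>W\<close>.\<close>

lemma deg_meeting_le:
  assumes \<A>: "\<A> \<subseteq> Gr scale k UNIV" "\<And>F. F \<in> \<A> \<Longrightarrow> F \<inter> W \<noteq> {0}"
    and W: "subspace W" "v \<notin> W" and k: "1 \<le> k"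
  shows "deg \<A> v \<le> through_count 0 1 - through_count (dim W) 1"
proof -
  have v: "v \<noteq> 0" using W subspace_0 by auto
  have "{F \<in> \<A>. v \<in> F} \<subseteq> through (span {v}) {0} - through (span {v}) W"
  proof safe
    fix F assume F: "F \<in> \<A>" "v \<in> F"
    hence "subspace F" "F \<in> Gr scale k UNIV" using \<A> by (auto simp: mem_Gr)
    thus "F \<in> through (span {v}) {0}"
      using F span_singleton_subset_iff unfolding through_trivial by blast
    assume "F \<in> through (span {v}) W"
    thus False using \<A>(2)[OF F(1)] by (simp add: through_def)
  qed
  hence "deg \<A> v \<le> real (card (through (span {v}) {0} - through (span {v}) W))"
    unfolding deg_def by (intro of_nat_mono card_mono) auto
  also have "\<dots> = real (card (through (span {v}) {0})) - real (card (through (span {v}) W))"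
  proof -
    have "through (span {v}) W \<subseteq> through (span {v}) {0}"
      by (auto simp: through_def mem_Gr subspace_0)
    thus ?thesis by (simp add: card_Diff_subset of_nat_diff card_mono)
  qed
  also have "\<dots> = through_count 0 1 - through_count (dim W) 1"
    using card_through[of "span {v}" "{0}"] card_through[of "span {v}" W]
      span_singleton_Int[OF W] W v k by (simp add: span_zero)
  finally show ?thesis .
qed

text \<open>Greedy extension that keeps the matching disjoint from \<open>W\<close>: if
  \<open>F\<close> is disjoint from \<open>U + W\<close>, then \<open>U\<close>, \<open>F\<close>
  and \<open>W\<close> together span a space of full dimension, so \<open>U + F\<close> is disjoint
  from \<open>W\<close> again.\<close>

lemma matching_chain:
  assumes \<A>: "\<A> \<subseteq> Gr scale k UNIV" and W: "subspace W"
    and ext: "\<And>l U. l < m \<Longrightarrow> matching \<A> l U \<Longrightarrow> U \<inter> W = {0} \<Longrightarrow> \<exists>F\<in>\<A>. F \<inter> span (U \<union> W) = {0}"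
  shows "\<exists>U. matching \<A> m U \<and> U \<inter> W = {0}"
  using ext
proof (induction m)
  case 0
  thus ?case using matching_0 W subspace_0 by blast
next
  case (Suc l)
  then obtain U where mU: "matching \<A> l U" and UW: "U \<inter> W = {0}" by (meson less_SucI)
  then obtain F where F: "F \<in> \<A>" "F \<inter> span (U \<union> W) = {0}" using Suc.prems by blast
  have U: "subspace U" "dim U = l * k" using matching_subspace[OF mU \<A>] .
  have sF: "subspace F" "dim F = k" using F \<A> by (auto simp: mem_Gr)
  have "F \<inter> U = {0}" using F(2) span_superset[of "U \<union> W"] subspace_0[OF U(1)] subspace_0[OF sF(1)] by auto
  hence m2: "matching \<A> (Suc l) (span (U \<union> F))" using matching_Suc[OF mU \<A> F(1)] by simp
  have "span (U \<union> W) \<union> F \<subseteq> span (span (U \<union> F) \<union> W)"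
    using span_mono[of "U \<union> W" "span (U \<union> F) \<union> W"] span_superset[of "U \<union> F"]
      span_superset[of "span (U \<union> F) \<union> W"] by blast
  hence "dim (span (span (U \<union> W) \<union> F)) \<le> dim (span (span (U \<union> F) \<union> W))"
    by (metis dim_mono dim_span)
  moreover have "dim (span (span (U \<union> W) \<union> F)) = l * k + dim W + k"
    using dim_span_Un_disjoint[OF subspace_span sF(1)] dim_span_Un_disjoint[OF U(1) W UW] F(2) U sF
    by (simp add: Int_commute)
  moreover have "dim (span (span (U \<union> F) \<union> W)) + dim (span (U \<union> F) \<inter> W) = l * k + dim W + k"
    using dim_span_Un[OF subspace_span W] matching_subspace[OF m2 \<A>] by simp
  ultimately have "dim (span (U \<union> F) \<inter> W) = 0" by linarith
  hence "span (U \<union> F) \<inter> W \<subseteq> {0}" by simp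
  thus ?case using m2 subspace_0[OF W] span_zero by blast
qed

lemma exists_disjoint:
  assumes "subspace W" "k + dim W \<le> n"
  obtains S where "S \<in> Gr scale k UNIV" "S \<inter> W = {0}"
proof -
  have "real (card (through {0} W)) > 0"
    using card_through[of "{0}" W] through_count_pos[OF assms(2), of 0] assms(1) subspace_0 by simp
  hence "through {0} W \<noteq> {}" by auto
  thus thesis using that by (auto simp: through_def)
qed

section \<open>Size of a family without a large matching\<close>

text \<open>All members meet a space \<open>Z\<close> of dimension at most \<open>M * k\<close>, so
  \<open>(q - 1) * card \<A>\<close> is at most the sum of the degrees over its nonzero vectors. The
  first term accounts for the vectors in the span of the heavy ones, bounded by full degree, and the
  second for the light vectors.\<close>

lemma card_bound_no_matching:
  assumes \<A>: "\<A> \<subseteq> Gr scale k UNIV" and k: "2 \<le> k" and M: "1 \<le> M" "k + M \<le> n"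
    and no: "\<nexists>U. matching \<A> (Suc M) U"
    and s: "(q ^ k - 1) * (through_count 0 1 - through_count M 1) < s"
    and \<sigma>: "\<And>S. S \<in> Gr scale k UNIV - \<A> \<Longrightarrow> s \<le> (\<Sum>v\<in>S - {0}. deg \<A> v)"
  shows "(q - 1) * real (card \<A>) \<le> (q ^ (M - 1) - 1) * through_count 0 1 + (q ^ (M * k) - 1)\<^sup>2 * through_count 0 2 / (q - 1)"
proof -
  have c2: "through_count 0 2 \<ge> 0" and c1: "through_count 0 1 \<ge> 0" using through_count_pos[of 0 2] through_count_pos[of 0 1] M by auto
  \<comment> \<open>The threshold bounds \<open>q - 1\<close> times the number of
    \<open>k\<close>-spaces through a vector that meet a given space of dimension at most
    \<open>M * k\<close> avoiding that vector.\<close>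
  define L where "L = (q ^ (M * k) - 1) * through_count 0 2"
  have L: "L \<ge> 0" using c2 q_power_le[of 0 "M * k"] by (simp add: L_def)
  define H where "H = {v. v \<noteq> 0 \<and> L < (q - 1) * deg \<A> v}"
  obtain B where B: "B \<subseteq> H" "independent B" "H \<subseteq> span B" "card B = dim H"
    using basis_exists by blast
  have finB: "finite B" by (rule finite_vectors)
  have heavy: "(q ^ (M * k) - 1) * through_count 0 2 < (q - 1) * deg \<A> b" if "b \<in> B" for b
    using that B(1) by (auto simp: H_def L_def)
  have light: "(q - 1) * deg \<A> v \<le> L" if "v \<notin> span B" for v
    using that B(3) span_zero by (force simp: H_def)
  define W where "W = span B"
  have W: "subspace W" "dim W = card B" using B(2) by (auto simp: W_def dim_eq_card_independent)
  \<comment> \<open>A matching of size \<open>l\<close> disjoint from \<open>W\<close> could be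
    completed to size \<open>Suc M\<close> by \<open>Suc M - l\<close> vectors of
    \<open>B\<close>.\<close>
  have no_comb: False
    if m: "matching \<A> l U" and UW: "U \<inter> W = {0}" and lB: "l \<le> Suc M" "Suc M \<le> l + card B" for l U
  proof -
    have U: "subspace U" "dim U = l * k" using matching_subspace[OF m \<A>] .
    have "Suc M - l \<le> card B" using lB by simp
    then obtain B' where B': "B' \<subseteq> B" "card B' = Suc M - l"
      using obtain_subset_with_card_n by blast
    have finB': "finite B'" using B' finB finite_subset by auto
    have "dim (span (U \<union> span B')) = l * k + card B'"
    proof -
      have "U \<inter> span B' = {0}" using UW span_mono[OF B'(1)] subspace_0[OF U(1)] span_zero by (auto simp: W_def)
      moreover have "dim (span B') = card B'"
        using B'(1) B(2) independent_mono dim_span_eq_card_independent by blast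
      ultimately show ?thesis using dim_span_Un_disjoint[OF U(1) subspace_span, of B'] U by simp
    qed
    also have "span (U \<union> span B') = span (U \<union> B')" by (simp add: span_Un span_span)
    finally have "dim (U \<union> B') = l * k + card B'" by simp
    thus False using matching_from_heavy[OF \<A> k m finB' _ _ _ c2, of M] heavy B' lB no by auto
  qed
  have wM: "card B < M"
  proof (rule ccontr)
    assume "\<not> card B < M"
    then consider "card B = M" | "Suc M \<le> card B" by linarith
    thus False
    proof cases
      case 1
      \<comment> \<open>A member disjoint from \<open>W\<close> would be a matching of size
        \<open>1\<close>, and the \<open>M\<close> vectors of \<open>B\<close> would complete
        it.\<close>
      have meet: "F \<inter> W \<noteq> {0}" if F: "F \<in> \<A>" for F
      proof
        assume FW: "F \<inter> W = {0}"
        have "matching \<A> (Suc 0) (span ({0} \<union> F))"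
          using F \<A> by (intro matching_Suc[OF matching_0]) (auto simp: mem_Gr subspace_0)
        moreover have "span ({0} \<union> F) = F"
          using F \<A> span_eq_iff[of F] subspace_0[of F] by (auto simp: mem_Gr insert_absorb)
        ultimately have "matching \<A> (Suc 0) F" by (simp only:)
        thus False using no_comb[of "Suc 0" F] FW 1 by simp
      qed
      \<comment> \<open>Since all members meet \<open>W\<close>, this \<open>S\<close> is not a
        member, but its degree is too small for the Ore condition.\<close>
      obtain S where S: "S \<in> Gr scale k UNIV" "S \<inter> W = {0}"
        using exists_disjoint[OF W(1)] W(2) 1 M by auto
      have sS: "subspace S" "dim S = k" using S by (auto simp: mem_Gr)
      have "s \<le> (\<Sum>v\<in>S - {0}. deg \<A> v)" using \<sigma> S meet by blast
      also have "\<dots> \<le> (\<Sum>v\<in>S - {0}. through_count 0 1 - through_count M 1)"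
      proof (rule sum_mono)
        fix v assume "v \<in> S - {0}"
        hence "v \<notin> W" using S(2) by auto
        thus "deg \<A> v \<le> through_count 0 1 - through_count M 1"
          using deg_meeting_le[OF \<A> meet W(1)] k W(2) 1 by simp
      qed
      also have "\<dots> = (q ^ k - 1) * (through_count 0 1 - through_count M 1)" using card_nonzero[OF sS(1)] sS by simp
      finally show False using s by simp
    next
      case 2
      thus False using no_comb[OF matching_0] subspace_0[OF W(1)] by auto
    qed
  qed
  \<comment> \<open>Unhindered, the greedy extension would reach size \<open>Suc M - card B\<close>,
    and the vectors of \<open>B\<close> would supply the rest. So it gets stuck at some
    \<open>U\<close>, and then every member meets \<open>span (U \<union> W)\<close>.\<close>
  have "\<not> (\<forall>l U. l < Suc M - card B \<longrightarrow> matching \<A> l U \<longrightarrow> U \<inter> W = {0} \<longrightarrow>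
           (\<exists>F\<in>\<A>. F \<inter> span (U \<union> W) = {0}))"
  proof
    assume *: "\<forall>l U. l < Suc M - card B \<longrightarrow> matching \<A> l U \<longrightarrow> U \<inter> W = {0} \<longrightarrow>
           (\<exists>F\<in>\<A>. F \<inter> span (U \<union> W) = {0})"
    have "\<exists>U. matching \<A> (Suc M - card B) U \<and> U \<inter> W = {0}"
      by (rule matching_chain[OF \<A> W(1)]) (use * in simp)
    then obtain U where "matching \<A> (Suc M - card B) U" "U \<inter> W = {0}" by blast
    thus False using no_comb[of "Suc M - card B" U] wM by simp
  qed
  then obtain l U where lU: "l < Suc M - card B" "matching \<A> l U" "U \<inter> W = {0}"
    "\<not> (\<exists>F\<in>\<A>. F \<inter> span (U \<union> W) = {0})"
    unfolding not_all not_imp by (elim exE conjE) (rule that)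
  have U: "subspace U" "dim U = l * k" using matching_subspace[OF lU(2) \<A>] .
  define Z where "Z = span (U \<union> W)"
  have Z: "subspace Z" "dim Z = l * k + card B" "W \<subseteq> Z"
    using dim_span_Un_disjoint[OF U(1) W(1) lU(3)] U W span_superset[of "U \<union> W"] by (auto simp: Z_def)
  have "dim Z \<le> M * k"
  proof -
    have "card B \<le> card B * k" using k by simp
    hence "dim Z \<le> (l + card B) * k" using Z(2) by (simp add: add_mult_distrib)
    also have "\<dots> \<le> M * k" using lU(1) by (intro mult_right_mono) auto
    finally show ?thesis .
  qed
  hence qZ: "q ^ dim Z \<le> q ^ (M * k)" by (rule q_power_le)
  have "(q - 1) * real (card \<A>) = (\<Sum>F\<in>\<A>. q - 1)" by simp
  also have "\<dots> \<le> (\<Sum>F\<in>\<A>. \<Sum>u\<in>F \<inter> (Z - {0}). 1)"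
  proof (rule sum_mono)
    fix F assume F: "F \<in> \<A>"
    hence "subspace F" using \<A> by (auto simp: mem_Gr)
    hence s: "subspace (F \<inter> Z)" using Z(1) by (rule subspace_inter)
    have "dim (F \<inter> Z) \<noteq> 0" using lU(4) F subspace_0[OF s] by (auto simp: Z_def)
    hence "q ^ 1 \<le> q ^ dim (F \<inter> Z)" by (intro q_power_le) linarith
    also have "q ^ dim (F \<inter> Z) - 1 = real (card (F \<inter> (Z - {0})))"
      using card_nonzero[OF s] by (simp add: Int_Diff)
    finally show "q - 1 \<le> (\<Sum>u\<in>F \<inter> (Z - {0}). 1)" by simp
  qed
  also have "\<dots> = (\<Sum>u\<in>Z - {0}. deg \<A> u)" unfolding sum_members_vectors by simp
  also have "\<dots> = (\<Sum>u\<in>W - {0}. deg \<A> u) + (\<Sum>u\<in>(Z - {0}) - (W - {0}). deg \<A> u)"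
    using Z(3) by (subst sum.subset_diff[of "W - {0}"]) (auto simp: finite_vectors)
  also have "(\<Sum>u\<in>W - {0}. deg \<A> u) \<le> (\<Sum>u\<in>W - {0}. through_count 0 1)"
  proof (rule sum_mono)
    fix u assume "u \<in> W - {0}"
    thus "deg \<A> u \<le> through_count 0 1" using deg_mono[OF \<A>, of u] deg_Gr[of u] k by simp
  qed
  also have "\<dots> = (q ^ card B - 1) * through_count 0 1" using card_nonzero[OF W(1)] W(2) by simp
  also have "\<dots> \<le> (q ^ (M - 1) - 1) * through_count 0 1"
    using wM c1 by (intro mult_right_mono diff_right_mono q_power_le) auto
  also have "(\<Sum>u\<in>(Z - {0}) - (W - {0}). deg \<A> u) \<le> (\<Sum>u\<in>(Z - {0}) - (W - {0}). L / (q - 1))"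
  proof (rule sum_mono)
    fix u assume "u \<in> (Z - {0}) - (W - {0})"
    hence "u \<notin> span B" by (auto simp: W_def)
    thus "deg \<A> u \<le> L / (q - 1)" using light q_ge_2 by (simp add: field_simps)
  qed
  also have "\<dots> \<le> (\<Sum>u\<in>Z - {0}. L / (q - 1))"
    using L q_ge_2 by (intro sum_mono2) (auto simp: finite_vectors)
  also have "\<dots> = (q ^ dim Z - 1) * (L / (q - 1))" using card_nonzero[OF Z(1)] by simp
  also have "\<dots> \<le> (q ^ (M * k) - 1) * (L / (q - 1))"
    using L q_ge_2 qZ by (intro mult_right_mono) auto
  finally show ?thesis by (simp add: L_def power2_eq_square mult_ac)
qed

section \<open>Numerical estimates for \<open>M \<ge> 2\<close>\<close>

text \<open>Bounds the Ore threshold from below by the fraction \<open>S / (1 + S)\<close> of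
  \<open>through_count 0 1\<close>. The quotient of the two counts is a product of factors
  \<open>1 - x i\<close>, and \<open>S\<close> is the geometric series obtained from the sum of the
  \<open>x i\<close> by enlarging each denominator to \<open>q ^ n\<close>.\<close>

lemma through_count_difference_ge:
  assumes "k + M \<le> n" "1 \<le> k"
  defines "S \<equiv> (q ^ M - 1) * (q ^ k - q) / ((q - 1) * q ^ n)"
  shows "through_count 0 1 * S \<le> (1 + S) * (through_count 0 1 - through_count M 1)"
proof -
  define x where "x i = (q ^ (i + M) - q ^ i) / (q ^ n - q ^ i)" for i
  have qi: "q ^ i < q ^ n" if "i < k" for i using assms that by (intro q_power_less) auto
  have x: "0 \<le> x i \<and> x i \<le> 1" if "i \<in> {1..<k}" for i
  proof -
    have "q ^ i \<le> q ^ (i + M)" "q ^ (i + M) \<le> q ^ n"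
      using that assms by (auto intro!: q_power_le)
    thus ?thesis using qi[of i] that by (simp add: x_def)
  qed
  have ccM: "through_count M 1 = through_count 0 1 * (\<Prod>i\<in>{1..<k}. 1 - x i)"
    unfolding through_count_def prod.distrib[symmetric]
  proof (rule prod.cong[OF refl])
    fix i assume "i \<in> {1..<k}"
    hence "q ^ n - q ^ i \<noteq> 0" using qi[of i] by auto
    hence "1 - x i = (q ^ n - q ^ (i + M)) / (q ^ n - q ^ i)"
      by (simp add: x_def field_simps)
    thus "(q ^ n - q ^ (i + M)) / (q ^ k - q ^ i) =
      (q ^ n - q ^ (i + 0)) / (q ^ k - q ^ i) * (1 - x i)"
      using \<open>q ^ n - q ^ i \<noteq> 0\<close> by simp
  qed
  have geo: "(\<Sum>i\<in>{1..<k}. q ^ i) * (q - 1) = q ^ k - q"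
    using assms(2)
  proof (induction k rule: dec_induct)
    case (step m)
    thus ?case by (simp add: algebra_simps)
  qed simp
  have S: "S = (\<Sum>i\<in>{1..<k}. (q ^ M - 1) * q ^ i / q ^ n)"
  proof -
    have "(\<Sum>i\<in>{1..<k}. (q ^ M - 1) * q ^ i / q ^ n) = (q ^ M - 1) / q ^ n * (\<Sum>i\<in>{1..<k}. q ^ i)"
      by (simp add: sum_distrib_left)
    also have "(\<Sum>i\<in>{1..<k}. q ^ i) = (q ^ k - q) / (q - 1)" using geo q_ge_2 by (simp add: field_simps)
    finally show ?thesis by (simp add: S_def mult_ac)
  qed
  have "S \<le> (\<Sum>i\<in>{1..<k}. x i)"
    unfolding S
  proof (rule sum_mono)
    fix i assume i: "i \<in> {1..<k}"
    have "(q ^ M - 1) * q ^ i / q ^ n \<le> (q ^ M - 1) * q ^ i / (q ^ n - q ^ i)"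
      using qi[of i] i q_ge_2 q_power_le[of 0 M] by (intro divide_left_mono mult_nonneg_nonneg mult_pos_pos) auto
    also have "\<dots> = x i" by (simp add: x_def power_add algebra_simps)
    finally show "(q ^ M - 1) * q ^ i / q ^ n \<le> x i" .
  qed
  moreover have "(\<Prod>i\<in>{1..<k}. 1 - x i) \<ge> 0" using x by (intro prod_nonneg) auto
  ultimately have "(\<Prod>i\<in>{1..<k}. 1 - x i) * (1 + S) \<le> (\<Prod>i\<in>{1..<k}. 1 - x i) * (1 + (\<Sum>i\<in>{1..<k}. x i))"
    by (intro mult_left_mono) auto
  also have "\<dots> \<le> 1" using x by (intro prod_one_minus_le) auto
  finally have "through_count 0 1 * ((\<Prod>i\<in>{1..<k}. 1 - x i) * (1 + S)) \<le> through_count 0 1 * 1"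
    using through_count_pos[of 0 1] assms by (intro mult_left_mono) auto
  thus ?thesis unfolding ccM by (simp add: algebra_simps)
qed

text \<open>Compares the two bounds on the family, both divided by \<open>through_count 0 1\<close>:
  the left side comes from the absence of a matching, the right side from the averaged Ore
  condition.\<close>

lemma geometric_estimate:
  assumes k: "2 \<le> k" and M: "2 \<le> M" and n: "(2 * M + 1) * k - M + 3 \<le> n"
  defines "S \<equiv> (q ^ M - 1) * (q ^ k - q) / ((q - 1) * q ^ n)"
  shows "(q ^ k - 1) * ((q ^ (M - 1) - 1) + (q ^ (M * k) - 1)\<^sup>2 * (q ^ k - q) / ((q ^ n - q) * (q - 1)))
     \<le> (q - 1) * (S / (1 + S)) * (q ^ n - 1)"
proof -
  have q: "q \<ge> 2" by (rule q_ge_2)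
  have Mk: "M * 2 \<le> M * k" using k by (rule mult_le_mono2)
  have "(2 * M + 1) * k = 2 * (M * k) + k" by (simp add: algebra_simps)
  \<comment> \<open>\<open>n1\<close> restates the bound on \<open>n\<close> without truncated
    subtraction; its \<open>3\<close> gives the factor \<open>8 = 2 ^ 3\<close> below, and the
    \<open>7\<close> in \<open>n2\<close> gives \<open>128 = 2 ^ 7\<close>.\<close>
  hence n1: "2 * (M * k) + k + 3 \<le> n + M" and n2: "M + k + 7 \<le> n" using n Mk M by linarith+
  have qk: "q ^ k \<ge> q\<^sup>2" and qM: "q ^ M \<ge> q\<^sup>2" using q_power_le[OF k] q_power_le[OF M] by auto
  have q2: "q\<^sup>2 \<ge> 2 * q" using q by (simp add: power2_eq_square)
  have kq: "q ^ k - q > 0" using qk q2 q by linarith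
  have two: "2 ^ j \<le> q ^ j" for j using q by (intro power_mono) auto
  have qn7: "q ^ n \<ge> 128 * (q ^ M * q ^ k)"
  proof -
    have "128 * q ^ (M + k) \<le> q ^ 7 * q ^ (M + k)" using two[of 7] q by (intro mult_right_mono) auto
    also have "\<dots> \<le> q ^ n" using q_power_le[OF n2] by (simp add: power_add mult_ac)
    finally show ?thesis by (simp add: power_add)
  qed
  define A where "A = q ^ M - 1"
  have A: "A \<ge> 3" using two[of 2] qM by (simp add: A_def)
  \<comment> \<open>The constant is the value of \<open>(q + 1) / q\<^sup>2\<close> at
    \<open>q = 2\<close>, the worst case.\<close>
  have t1: "(q ^ k - 1) / (q ^ k - q) * (q ^ (M - 1) - 1) \<le> 3 / 4 * A"
  proof -
    have "(q ^ k - 1) / (q ^ k - q) \<le> (q + 1) / q"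
      using kq q qk by (simp add: field_simps power2_eq_square)
    moreover have "q ^ (M - 1) - 1 = (q ^ M - q) / q"
      using M q by (simp add: power_diff field_simps)
    moreover have "q ^ M - q \<ge> 0" using qM q2 q by linarith
    ultimately have "(q ^ k - 1) / (q ^ k - q) * (q ^ (M - 1) - 1) \<le> (q + 1) / q * ((q ^ M - q) / q)"
      using q by (metis divide_nonneg_nonneg mult_right_mono order_trans zero_le_numeral)
    also have "\<dots> = (q + 1) / q\<^sup>2 * (q ^ M - q)" by (simp add: power2_eq_square)
    also have "(q + 1) / q\<^sup>2 \<le> 3 / 4"
    proof -
      have "0 \<le> (q - 2) * (3 * q + 2)" using q by (intro mult_nonneg_nonneg) auto
      thus ?thesis using q by (simp add: field_simps power2_eq_square)
    qed
    hence "(q + 1) / q\<^sup>2 * (q ^ M - q) \<le> 3 / 4 * (q ^ M - q)"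
      using \<open>q ^ M - q \<ge> 0\<close> by (intro mult_right_mono)
    also have "\<dots> \<le> 3 / 4 * A" using q by (simp add: A_def)
    finally show ?thesis .
  qed
  \<comment> \<open>The constant is \<open>(1 / 8) * (4 / 3) * (16 / 15)\<close>: the first factor
    comes from \<open>n1\<close>, the second from \<open>A \<ge> 3\<close>, the third from
    \<open>16 * q \<le> q ^ n\<close>.\<close>
  have t2: "(q ^ k - 1) * (q ^ (M * k) - 1)\<^sup>2 / ((q ^ n - q) * (q - 1)) \<le> 8 / 45 * A"
  proof -
    have "q ^ (M * k) \<ge> 1" "q ^ k \<ge> 1" using q by auto
    hence "(q ^ k - 1) * (q ^ (M * k) - 1)\<^sup>2 \<le> q ^ k * (q ^ (M * k))\<^sup>2"
      by (intro mult_mono power_mono) auto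
    also have "\<dots> = q ^ (2 * (M * k) + k)" by (simp add: power_add power_mult mult_ac flip: power_mult)
    finally have a: "(q ^ k - 1) * (q ^ (M * k) - 1)\<^sup>2 \<le> q ^ (2 * (M * k) + k)" .
    have "8 * q ^ (2 * (M * k) + k) \<le> q ^ 3 * q ^ (2 * (M * k) + k)"
      using two[of 3] q by (intro mult_right_mono) auto
    also have "\<dots> \<le> q ^ n * q ^ M" using q_power_le[OF n1] by (simp add: power_add mult_ac)
    finally have b: "8 * q ^ (2 * (M * k) + k) \<le> q ^ n * q ^ M" .
    have c: "q ^ M \<le> 4 / 3 * A" using A by (simp add: A_def)
    have "q ^ M * q ^ k \<ge> 1 * q ^ k" using A q by (intro mult_right_mono) (auto simp: A_def)
    hence "16 * q \<le> q ^ n" using qn7 qk q2 q by linarith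
    hence d: "15 / 16 * q ^ n \<le> (q ^ n - q) * (q - 1)"
    proof -
      have "15 / 16 * q ^ n \<le> (q ^ n - q) * 1" using \<open>16 * q \<le> q ^ n\<close> by simp
      also have "\<dots> \<le> (q ^ n - q) * (q - 1)" using \<open>16 * q \<le> q ^ n\<close> q by (intro mult_left_mono) auto
      finally show ?thesis .
    qed
    have "q ^ n > 0" using q by simp
    have "(q ^ k - 1) * (q ^ (M * k) - 1)\<^sup>2 \<le> q ^ n * q ^ M / 8" using a b by simp
    also have "\<dots> \<le> q ^ n * (4 / 3 * A) / 8" using c \<open>q ^ n > 0\<close> by simp
    also have "\<dots> = 8 / 45 * A * (15 / 16 * q ^ n)" by simp
    also have "\<dots> \<le> 8 / 45 * A * ((q ^ n - q) * (q - 1))" using d A by (intro mult_left_mono) auto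
    finally show ?thesis using d \<open>q ^ n > 0\<close> by (subst pos_divide_le_eq) auto
  qed
  have S0: "S \<ge> 0" unfolding S_def using A kq q by (intro divide_nonneg_nonneg mult_nonneg_nonneg) (auto simp: A_def)
  have S1: "S \<le> 1 / 128"
  proof -
    have "128 * ((q ^ M - 1) * (q ^ k - q)) \<le> 128 * (q ^ M * q ^ k)"
      using A kq q by (intro mult_left_mono mult_mono) (auto simp: A_def)
    also have "\<dots> \<le> 1 * q ^ n" using qn7 by simp
    also have "\<dots> \<le> (q - 1) * q ^ n" using q by (intro mult_right_mono) auto
    finally show ?thesis using q by (simp add: S_def field_simps)
  qed
  have qn: "q ^ n \<ge> 128"
  proof -
    have "q ^ M * q ^ k \<ge> 1 * 1" using q by (intro mult_mono) auto
    thus ?thesis using qn7 by linarith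
  qed
  have "(q ^ k - 1) * ((q ^ (M - 1) - 1) + (q ^ (M * k) - 1)\<^sup>2 * (q ^ k - q) / ((q ^ n - q) * (q - 1)))
      = (q ^ k - q) * ((q ^ k - 1) / (q ^ k - q) * (q ^ (M - 1) - 1) +
          (q ^ k - 1) * (q ^ (M * k) - 1)\<^sup>2 / ((q ^ n - q) * (q - 1)))"
    using kq by (simp add: distrib_left)
  also have "\<dots> \<le> (q ^ k - q) * (3 / 4 * A + 8 / 45 * A)"
    using t1 t2 kq by (intro mult_left_mono add_mono) auto
  \<comment> \<open>The two contributions add up to \<open>167 / 180\<close>, which is below
    \<open>127 / 129\<close>.\<close>
  also have "\<dots> \<le> (q ^ k - q) * (A * (127 / 128) / (129 / 128))"
    using A kq by (intro mult_left_mono) auto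
  also have "\<dots> \<le> (q ^ k - q) * (A * ((q ^ n - 1) / q ^ n) / (1 + S))"
  proof -
    have "127 / 128 \<le> (q ^ n - 1) / q ^ n" using qn by (simp add: field_simps)
    hence "A * (127 / 128) / (129 / 128) \<le> A * ((q ^ n - 1) / q ^ n) / (1 + S)"
      using A S0 S1 qn by (intro frac_le[of "A * ((q ^ n - 1) / q ^ n)"] mult_left_mono) auto
    thus ?thesis using kq by (intro mult_left_mono) auto
  qed
  also have "\<dots> = (q - 1) * (S / (1 + S)) * (q ^ n - 1)"
    using q by (simp add: S_def A_def)
  finally show ?thesis .
qed

text \<open>Without a matching, the averaged Ore condition makes the family too large for
  \<open>card_bound_no_matching\<close>: the chain of inequalities, one of them strict, returns to
  its starting expression.\<close>

lemma matching_exists_ge_2: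
  assumes \<A>: "\<A> \<subset> Gr scale k UNIV" and k: "2 \<le> k" and M: "2 \<le> M" and n: "(2 * M + 1) * k - M + 3 \<le> n"
    and s: "(q ^ k - 1) * (through_count 0 1 - through_count M 1) < s"
    and \<sigma>: "\<And>S. S \<in> Gr scale k UNIV - \<A> \<Longrightarrow> s \<le> (\<Sum>v\<in>S - {0}. deg \<A> v)"
  shows "\<exists>U. matching \<A> (Suc M) U"
proof (rule ccontr)
  assume no: "\<not> ?thesis"
  have "M * 2 \<le> M * k" using k by (rule mult_le_mono2)
  moreover have "(2 * M + 1) * k = 2 * (M * k) + k" by (simp add: algebra_simps)
  ultimately have kM: "k + M + 3 \<le> n" using n by linarith
  define P1 where "P1 = through_count 0 1"
  have P1: "P1 > 0" using through_count_pos[of 0 1] kM by (simp add: P1_def)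
  define X where "X = (q ^ (M * k) - 1)\<^sup>2"
  define S where "S = (q ^ M - 1) * (q ^ k - q) / ((q - 1) * q ^ n)"
  have q: "q \<ge> 2" by (rule q_ge_2)
  have qn: "q ^ n > q" using q_power_less[of 1 n] kM k by simp
  have qk: "q ^ k > q" using q_power_less[of 1 k] k by simp
  have S: "S \<ge> 0" unfolding S_def using q qk by (intro divide_nonneg_nonneg mult_nonneg_nonneg) auto
  have P2: "through_count 0 2 = P1 * (q ^ k - q) / (q ^ n - q)"
    unfolding P1_def using kM k by (intro through_count_0_2) auto
  have "(q ^ k - 1) * (through_count 0 1 - through_count M 1) * (q ^ n - 1) < s * (q ^ n - 1)"
    using s qn q by (intro mult_strict_right_mono) auto
  also have "\<dots> \<le> (q ^ k - 1)\<^sup>2 * real (card \<A>)"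
    using ore_averaging[OF \<A> _ _ \<sigma>] k kM by simp
  finally have "(q ^ k - 1) * ((through_count 0 1 - through_count M 1) * (q ^ n - 1)) < (q ^ k - 1) * ((q ^ k - 1) * real (card \<A>))"
    by (simp add: power2_eq_square mult_ac)
  hence "(through_count 0 1 - through_count M 1) * (q ^ n - 1) < (q ^ k - 1) * real (card \<A>)"
    using qk q by (simp add: mult_less_cancel_left_pos)
  hence "(q - 1) * ((through_count 0 1 - through_count M 1) * (q ^ n - 1)) < (q - 1) * ((q ^ k - 1) * real (card \<A>))"
    using q by simp
  also have "\<dots> = (q ^ k - 1) * ((q - 1) * real (card \<A>))" by simp
  also have "\<dots> \<le> (q ^ k - 1) * ((q ^ (M - 1) - 1) * through_count 0 1 + X * through_count 0 2 / (q - 1))"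
    using card_bound_no_matching[OF psubset_imp_subset[OF \<A>] k _ _ _ s \<sigma>] no M kM qk q unfolding X_def
    by (intro mult_left_mono) auto
  also have "\<dots> = P1 * ((q ^ k - 1) * ((q ^ (M - 1) - 1) + X * (q ^ k - q) / ((q ^ n - q) * (q - 1))))"
    unfolding P2 P1_def[symmetric] by (simp add: algebra_simps)
  also have "\<dots> \<le> P1 * ((q - 1) * (S / (1 + S)) * (q ^ n - 1))"
    unfolding X_def S_def using geometric_estimate[OF k M n] P1 by (intro mult_left_mono) auto
  also have "\<dots> = (q - 1) * ((P1 * S / (1 + S)) * (q ^ n - 1))" by simp
  also have "\<dots> \<le> (q - 1) * ((through_count 0 1 - through_count M 1) * (q ^ n - 1))"
  proof -
    have "P1 * S \<le> (1 + S) * (through_count 0 1 - through_count M 1)"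
      unfolding S_def P1_def using through_count_difference_ge[of M] kM k by simp
    hence "P1 * S / (1 + S) \<le> through_count 0 1 - through_count M 1" using S by (simp add: divide_le_eq mult.commute)
    thus ?thesis using q qn by (intro mult_left_mono mult_right_mono) auto
  qed
  finally show False by simp
qed

end

section \<open>The spectrum of the q-Kneser operator\<close>

text \<open>Gram--Schmidt by induction on \<open>Y\<close>: the new vector \<open>w z\<close> is
  replaced with its component \<open>u\<close> orthogonal to the earlier ones, and the projection
  onto \<open>u\<close> is subtracted from \<open>g\<close>.\<close>

lemma orthogonal_split:
  fixes f :: "'x \<Rightarrow> real" and w :: "'y \<Rightarrow> 'x \<Rightarrow> real"
  assumes "finite Y"
  shows "\<exists>g h. (\<forall>x. f x = g x + (\<Sum>y\<in>Y. h y * w y x)) \<and> (\<forall>y\<in>Y. (\<Sum>x\<in>X. g x * w y x) = 0)"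
  using assms
proof (induction Y arbitrary: f rule: finite_induct)
  case empty
  show ?case by (rule exI[of _ f]) auto
next
  case (insert z Y)
  obtain g h where gh: "\<And>x. f x = g x + (\<Sum>y\<in>Y. h y * w y x)" "\<And>y. y \<in> Y \<Longrightarrow> (\<Sum>x\<in>X. g x * w y x) = 0"
    using insert.IH[of f] by blast
  obtain u e where ue: "\<And>x. w z x = u x + (\<Sum>y\<in>Y. e y * w y x)" "\<And>y. y \<in> Y \<Longrightarrow> (\<Sum>x\<in>X. u x * w y x) = 0"
    using insert.IH[of "w z"] by blast
  define U where "U = (\<Sum>x\<in>X. u x * u x)"
  \<comment> \<open>The vectors need not be independent. If \<open>U = 0\<close>, the inner product
    with \<open>u\<close> vanishes and no correction is made.\<close>
  define c where "c = (if U = 0 then 0 else (\<Sum>x\<in>X. g x * u x) / U)"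
  have gz: "(\<Sum>x\<in>X. v x * w z x) = (\<Sum>x\<in>X. v x * u x)"
    if "\<And>y. y \<in> Y \<Longrightarrow> (\<Sum>x\<in>X. v x * w y x) = 0" for v
  proof -
    have "(\<Sum>x\<in>X. v x * w z x) = (\<Sum>x\<in>X. v x * u x) + (\<Sum>x\<in>X. \<Sum>y\<in>Y. e y * (v x * w y x))"
      unfolding ue(1) by (simp add: distrib_left sum.distrib sum_distrib_left mult_ac)
    also have "(\<Sum>x\<in>X. \<Sum>y\<in>Y. e y * (v x * w y x)) = (\<Sum>y\<in>Y. e y * (\<Sum>x\<in>X. v x * w y x))"
      by (subst sum.swap) (simp add: sum_distrib_left)
    also have "\<dots> = 0" using that by simp
    finally show ?thesis by simp
  qed
  let ?g = "\<lambda>x. g x - c * u x"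
  have orth: "(\<Sum>x\<in>X. ?g x * w y x) = 0" if "y \<in> Y" for y
    using gh(2)[OF that] ue(2)[OF that]
    by (simp add: left_diff_distrib sum_subtractf mult.assoc flip: sum_distrib_left)
  have "(\<Sum>x\<in>X. ?g x * w z x) = (\<Sum>x\<in>X. ?g x * u x)" using orth by (rule gz)
  also have "\<dots> = (\<Sum>x\<in>X. g x * u x) - c * U"
    by (simp add: left_diff_distrib sum_subtractf mult.assoc U_def flip: sum_distrib_left)
  also have "\<dots> = 0"
  proof (cases "U = 0")
    case True
    hence "\<forall>x\<in>X. u x = 0 \<or> infinite X"
      unfolding U_def by (cases "finite X") (auto simp: sum_nonneg_eq_0_iff)
    hence "(\<Sum>x\<in>X. g x * u x) = 0" by (cases "finite X") auto
    thus ?thesis using True by (simp add: c_def)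
  qed (simp add: c_def)
  finally have "(\<Sum>x\<in>X. ?g x * w z x) = 0" .
  moreover have "f x = ?g x + (\<Sum>y\<in>insert z Y. (if y = z then c else h y - c * e y) * w y x)" for x
  proof -
    have "(\<Sum>y\<in>insert z Y. (if y = z then c else h y - c * e y) * w y x) =
      c * w z x + (\<Sum>y\<in>Y. (h y - c * e y) * w y x)"
      using insert.hyps by (subst sum.insert) (auto intro!: sum.cong)
    also have "(\<Sum>y\<in>Y. (h y - c * e y) * w y x) = (\<Sum>y\<in>Y. h y * w y x) - c * (\<Sum>y\<in>Y. e y * w y x)"
      by (simp add: left_diff_distrib sum_subtractf sum_distrib_left mult.assoc)
    finally show ?thesis using gh(1)[of x] ue(1)[of x] by (simp add: algebra_simps)
  qed
  ultimately show ?case using orth by (intro exI[of _ ?g] exI[of _ "\<lambda>y. if y = z then c else h y - c * e y"]) auto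
qed

text \<open>
  Here \<open>K = [k]\<close>, \<open>N = [n]\<close>, \<open>a\<close> is the density of the family and \<open>\<phi>\<close> the normalised square norm
  of its component in the first nontrivial eigenspace.
\<close>

lemma spectral_contradiction:
  fixes K N a \<phi> :: real
  assumes K: "3 \<le> K" "K < N" and a: "0 < a" "a < 1" and \<phi>: "\<phi> \<le> a * (1 - a)"
    and 1: "\<phi> * (N - K) < (1 - a) * K * ((N - 1) * a - (K - 1))"
    and 2: "a\<^sup>2 * (N - K) \<le> K * (\<phi> + (a * (1 - a) - \<phi>) / 3)"
  shows False
proof -
  define y d where "y = 1 - a" and "d = K - a * N"
  have y: "y > 0" using a by (simp add: y_def)
  \<comment> \<open>Using only \<open>\<phi> \<le> a * (1 - a)\<close>, the second inequality gives
    the ratio bound \<open>a * N \<le> K\<close>; \<open>d\<close> measures the distance from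
    equality.\<close>
  have "a * (a * (N - K)) \<le> a * (K * y)"
  proof -
    have "\<phi> + (a * (1 - a) - \<phi>) / 3 \<le> a * (1 - a)"
    proof -
      have "x + (z - x) / 3 \<le> z" if "x \<le> z" for x z :: real using that by (simp add: field_simps)
      thus ?thesis using \<phi> .
    qed
    hence "K * (\<phi> + (a * (1 - a) - \<phi>) / 3) \<le> K * (a * (1 - a))" using K by (intro mult_left_mono) auto
    thus ?thesis using 2 by (simp add: y_def power2_eq_square mult_ac)
  qed
  hence "a * (N - K) \<le> K * y" using a by simp
  hence d: "d \<ge> 0" by (simp add: d_def y_def algebra_simps)
  have aN: "a * (N - K) = K * y - d" "(N - 1) * a - (K - 1) = y - d"
    by (simp_all add: y_def d_def algebra_simps)
  \<comment> \<open>Multiplying the second inequality by \<open>N - K\<close> lets the first one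
    eliminate \<open>\<phi>\<close>. What remains says that
    \<open>3 * d\<^sup>2 + K * y * d * (2 * K - 5)\<close> is negative.\<close>
  have "(K * y - d)\<^sup>2 = (a\<^sup>2 * (N - K)) * (N - K)"
    unfolding aN(1)[symmetric] by (simp add: power2_eq_square mult_ac)
  also have "\<dots> \<le> (K * (\<phi> + (a * (1 - a) - \<phi>) / 3)) * (N - K)"
    using 2 K by (intro mult_right_mono) auto
  also have "\<dots> = 2 / 3 * K * (\<phi> * (N - K)) + K * y * (a * (N - K)) / 3"
    by (simp add: y_def algebra_simps add_divide_distrib diff_divide_distrib)
  also have "\<dots> < 2 / 3 * K * (y * K * (y - d)) + K * y * (a * (N - K)) / 3"
    using 1 K unfolding aN(2) y_def[symmetric] by simp
  finally have "(K * y - d)\<^sup>2 < 2 / 3 * K * (y * K * (y - d)) + K * y * (K * y - d) / 3"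
    unfolding aN(1) .
  hence "3 * (K * y - d)\<^sup>2 < 2 * K * (y * K * (y - d)) + K * y * (K * y - d)"
    by linarith
  moreover have "3 * (K * y - d)\<^sup>2 - (2 * K * (y * K * (y - d)) + K * y * (K * y - d)) =
      3 * d\<^sup>2 + (K * y * d) * (2 * K - 5)"
    by algebra
  moreover have "(K * y * d) * (2 * K - 5) \<ge> 0"
    using K y d by (intro mult_nonneg_nonneg) auto
  ultimately show False using zero_le_power2[of d] by linarith
qed

context finite_vector_space
begin

abbreviation G :: "'v set set" where "G \<equiv> Gr scale k UNIV"

section \<open>Functions on the \<open>k\<close>-spaces and operators on them\<close>

definition ip :: "('v set \<Rightarrow> real) \<Rightarrow> ('v set \<Rightarrow> real) \<Rightarrow> real" where
  "ip f g = (\<Sum>S\<in>G. f S * g S)"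

text \<open>The inclusion operator, which turns functions on \<open>k\<close>-spaces into functions
  on smaller subspaces.\<close>

definition up :: "('v set \<Rightarrow> real) \<Rightarrow> 'v set \<Rightarrow> real" where
  "up f J = (\<Sum>S\<in>through J {0}. f S)"

text \<open>
  The spaces \<open>ker j\<close> decrease with \<open>j \<le> k\<close>; the orthogonal complement of \<open>ker j\<close> inside
  \<open>ker (j - 1)\<close> is the \<open>j\<close>-th eigenspace of the Grassmann scheme.
\<close>

definition ker :: "nat \<Rightarrow> ('v set \<Rightarrow> real) \<Rightarrow> bool" where
  "ker j f \<longleftrightarrow> (\<forall>J\<in>Gr scale j UNIV. up f J = 0)"

text \<open>The adjacency operator of the graph that joins two \<open>k\<close>-spaces when they
  meet trivially.\<close>

definition kneser :: "('v set \<Rightarrow> real) \<Rightarrow> 'v set \<Rightarrow> real" where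
  "kneser f F = (\<Sum>S\<in>through {0} F. f S)"

lemma ip_commute: "ip f g = ip g f"
  by (simp add: ip_def mult.commute)

lemma ip_cong: "(\<And>S. S \<in> G \<Longrightarrow> f S = f' S) \<Longrightarrow> (\<And>S. S \<in> G \<Longrightarrow> g S = g' S) \<Longrightarrow> ip f g = ip f' g'"
  by (simp add: ip_def)

lemma ip_add_right: "ip f (\<lambda>S. g S + h S) = ip f g + ip f h"
  and ip_add_left: "ip (\<lambda>S. g S + h S) f = ip g f + ip h f"
  and ip_mult_right: "ip f (\<lambda>S. c * g S) = c * ip f g"
  by (simp_all add: ip_def algebra_simps sum.distrib sum_distrib_left)

lemma ip_self_nonneg: "ip f f \<ge> 0"
  by (simp add: ip_def sum_nonneg)

lemma ip_self_eq_0: "ip f f = 0 \<Longrightarrow> S \<in> G \<Longrightarrow> f S = 0"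
  by (auto simp: ip_def sum_nonneg_eq_0_iff)

lemma up_eq: "up f J = (\<Sum>S\<in>G. if J \<subseteq> S then f S else 0)"
  unfolding up_def through_trivial by (rule sum.inter_filter) simp

lemma kneser_eq: "kneser f F = (\<Sum>S\<in>G. if S \<inter> F = {0} then f S else 0)"
proof -
  have "through {0} F = {S \<in> G. S \<inter> F = {0}}" by (auto simp: through_def)
  thus ?thesis unfolding kneser_def by (simp add: sum.inter_filter)
qed

lemma up_add: "up (\<lambda>S. f S + g S) J = up f J + up g J"
  and up_mult: "up (\<lambda>S. c * f S) J = c * up f J"
  by (simp_all add: up_def sum.distrib sum_distrib_left)

lemma kneser_add: "kneser (\<lambda>S. f S + g S) J = kneser f J + kneser g J"
  by (simp_all add: kneser_def sum.distrib sum_distrib_left)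

lemma ip_kneser: "ip f (kneser g) = ip (kneser f) g"
proof -
  have "ip f (kneser g) = (\<Sum>F\<in>G. \<Sum>S\<in>G. if S \<inter> F = {0} then f F * g S else 0)"
    unfolding ip_def kneser_eq by (auto simp: sum_distrib_left intro!: sum.cong)
  also have "\<dots> = (\<Sum>S\<in>G. \<Sum>F\<in>G. if S \<inter> F = {0} then f F * g S else 0)" by (rule sum.swap)
  also have "\<dots> = ip (kneser f) g"
    unfolding ip_def kneser_eq by (auto simp: sum_distrib_right Int_commute intro!: sum.cong)
  finally show ?thesis .
qed

text \<open>The recursion for \<open>through\<close> with \<open>S = {0}\<close> expresses
  \<open>up f J\<close>, up to a positive factor, as a sum of values of \<open>up f\<close> on
  spaces one dimension larger.\<close>

lemma ker_pred:
  assumes "ker (Suc j) f" "Suc j \<le> k"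
  shows "ker j f"
  unfolding ker_def
proof
  fix J assume "J \<in> Gr scale j UNIV"
  hence J: "subspace J" "dim J = j" by (auto simp: mem_Gr)
  have sp: "span J = J" using J(1) by (rule span_id)
  have "(q ^ k - q ^ j) * up f J = (\<Sum>v\<in>-J. up f (span (insert v J)))"
    using sum_through_span_insert[OF J(1) subspace_single_0, of f] J sp by (simp add: up_def)
  also have "\<dots> = 0"
  proof (rule sum.neutral, rule ballI)
    fix v assume v: "v \<in> -J"
    have "v \<notin> span J" using v J(1) by (simp add: span_id)
    hence "span (insert v J) \<in> Gr scale (Suc j) UNIV" using J by (simp add: mem_Gr dim_insert)
    thus "up f (span (insert v J)) = 0" using assms(1) by (simp add: ker_def)
  qed
  finally show "up f J = 0" using q_power_less[of j k] assms(2) by simp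
qed

lemma ker_le:
  assumes "ker j f" "i \<le> j" "j \<le> k"
  shows "ker i f"
  using assms(2,1,3)
proof (induction rule: inc_induct)
  case (step m)
  thus ?case using ker_pred[of m f] by simp
qed

section \<open>Eigenvalues of the Kneser operator\<close>

text \<open>This is \<open>(-1) ^ j * q ^ (j * (j - 1) / 2)\<close>, the Moebius function of the
  lattice of subspaces of a \<open>j\<close>-space.\<close>

definition mobius_coeff :: "nat \<Rightarrow> real" where
  "mobius_coeff j = (\<Prod>i<j. - (q ^ i))"

text \<open>
  Induction on \<open>dim J\<close> with a hyperplane \<open>J0\<close> of \<open>J\<close>: the members of \<open>through I J0\<close> outside
  \<open>through I J\<close> meet \<open>J\<close> in exactly one point, and that point can be added to \<open>I\<close>.
\<close>

lemma sum_through_disjoint: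
  assumes ker: "\<And>i. i < j \<Longrightarrow> ker i f"
    and "subspace I" "subspace J" "I \<inter> J = {0}" "dim I + dim J \<le> j"
  shows "(\<Sum>F\<in>through I J. f F) = mobius_coeff (dim J) * up f (span (I \<union> J))"
  using assms(2-)
proof (induction "dim J" arbitrary: I J)
  case 0
  hence J: "J = {0}" using subspace_0[of J] by auto
  show ?case using 0(2) by (simp add: J mobius_coeff_def up_def span_id)
next
  case (Suc b J I)
  obtain J0 where J0: "subspace J0" "J0 \<subseteq> J" "dim J0 = b"
    using choose_subspace_of_subspace[of b J] Suc.hyps(2) Suc.prems(2) by (auto simp: span_id)
  have IJ0: "I \<inter> J0 = {0}" using Suc.prems J0 subspace_0 by blast
  have IH: "(\<Sum>F\<in>through I' J0. f F) = mobius_coeff b * up f (span (I' \<union> J0))"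
    if "subspace I'" "I' \<inter> J0 = {0}" "dim I' + b \<le> j" for I'
    using Suc.hyps(1)[of J0 I'] that J0 by simp
  have "span (I \<union> J0) \<in> Gr scale (dim I + b) UNIV"
    using dim_span_Un_disjoint[OF Suc.prems(1) J0(1) IJ0] J0 by (simp add: mem_Gr)
  \<comment> \<open>The dimension \<open>dim I + b\<close> is below \<open>j\<close>. Hence the sum
    over \<open>through I J0\<close> vanishes, and the sum over \<open>through I J\<close> is minus
    the contribution of the remaining spaces.\<close>
  hence "up f (span (I \<union> J0)) = 0"
    using ker[of "dim I + b"] Suc.prems(4) Suc.hyps(2) by (simp add: ker_def)
  hence zero: "(\<Sum>F\<in>through I J0. f F) = 0"
    using IH[OF Suc.prems(1) IJ0] Suc.prems(4) Suc.hyps(2) by simp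
  have sub: "through I J \<subseteq> through I J0"
    using J0 subspace_0[OF J0(1)] by (auto simp: through_def)
  have "(\<Sum>v\<in>J - J0. \<Sum>F\<in>{F \<in> through I J0. v \<in> F}. f F) =
        (\<Sum>v\<in>J - J0. \<Sum>F\<in>through I J0. if v \<in> F then f F else 0)"
    by (intro sum.cong refl sum.inter_filter) simp
  also have "\<dots> = (\<Sum>F\<in>through I J0. \<Sum>v\<in>J - J0. if v \<in> F then f F else 0)" by (rule sum.swap)
  also have "\<dots> = (\<Sum>F\<in>through I J0. real (card ((J - J0) \<inter> F)) * f F)"
    by (rule sum.cong[OF refl], subst sum.inter_restrict[symmetric]) (auto simp: finite_vectors)
  also have "\<dots> = (\<Sum>F\<in>through I J0. if F \<in> through I J then 0 else (q - 1) * f F)"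
  proof (rule sum.cong[OF refl])
    fix F assume F: "F \<in> through I J0"
    hence sF: "subspace F" "F \<inter> J0 = {0}" "F \<in> G" "I \<subseteq> F" by (auto simp: through_def mem_Gr)
    show "real (card ((J - J0) \<inter> F)) * f F = (if F \<in> through I J then 0 else (q - 1) * f F)"
    proof (cases "F \<in> through I J")
      case True
      hence "F \<inter> J \<subseteq> J0" using subspace_0[OF J0(1)] by (simp add: through_def)
      hence "(J - J0) \<inter> F = {}" by blast
      thus ?thesis using True by simp
    next
      case False
      have s: "subspace (F \<inter> J)" using sF Suc.prems by (intro subspace_inter)
      have "F \<inter> J \<noteq> {0}" using False sF by (auto simp: through_def)
      hence "dim (F \<inter> J) \<noteq> 0" using subspace_0[OF s] by auto
      moreover have "dim (span ((F \<inter> J) \<union> J0)) = dim (F \<inter> J) + b"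
      proof -
        have "F \<inter> J \<inter> J0 = {0}" using sF(2) J0(2) by blast
        thus ?thesis using dim_span_Un_disjoint[OF s J0(1)] J0 by simp
      qed
      moreover have "dim (span ((F \<inter> J) \<union> J0)) \<le> dim J"
        using J0(2) Suc.prems(2) by (intro dim_subset span_minimal) auto
      ultimately have "dim (F \<inter> J) = 1" using Suc.hyps(2) by linarith
      hence "real (card (F \<inter> J - {0})) = q - 1" using card_nonzero[OF s] by simp
      moreover have "(J - J0) \<inter> F = F \<inter> J - {0}" using sF(2) by blast
      ultimately show ?thesis using False by simp
    qed
  qed
  also have "\<dots> = (\<Sum>F\<in>through I J0 - through I J. (q - 1) * f F)"
    by (rule sum.mono_neutral_cong_right) auto
  also have "\<dots> = (q - 1) * ((\<Sum>F\<in>through I J0. f F) - (\<Sum>F\<in>through I J. f F))"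
    using sub by (simp add: sum_distrib_left[symmetric] sum_diff)
  finally have "(\<Sum>v\<in>J - J0. \<Sum>F\<in>{F \<in> through I J0. v \<in> F}. f F) = (q - 1) * (- (\<Sum>F\<in>through I J. f F))"
    using zero by simp
  moreover have "(\<Sum>v\<in>J - J0. \<Sum>F\<in>{F \<in> through I J0. v \<in> F}. f F) =
      (\<Sum>v\<in>J - J0. mobius_coeff b * up f (span (I \<union> J)))"
  proof (rule sum.cong[OF refl])
    fix v assume v: "v \<in> J - J0"
    have v0: "v \<noteq> 0" using v subspace_0[OF J0(1)] by auto
    hence vI: "v \<notin> I" using v Suc.prems(3) by blast
    have d: "dim (span (insert v I)) = Suc (dim I)"
      using vI Suc.prems(1) by (simp add: dim_insert span_id)
    have disj: "span (insert v I) \<inter> J0 = {0}"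
    proof -
      have "x = 0" if x: "x \<in> span (insert v I)" "x \<in> J0" for x
      proof -
        obtain c where c: "x - c *s v \<in> I"
          using x(1) Suc.prems(1) by (auto simp: span_breakdown_eq span_id)
        moreover have "x - c *s v \<in> J"
          using x(2) J0(2) v Suc.prems(2) by (intro subspace_diff subspace_scale) auto
        ultimately have "x - c *s v \<in> I \<inter> J" by blast
        hence xc: "x = c *s v" using Suc.prems(3) by simp
        have "c = 0"
        proof (rule ccontr)
          assume "c \<noteq> 0"
          hence "v = inverse c *s x" using xc by simp
          thus False using v subspace_scale[OF J0(1) x(2)] by auto
        qed
        thus ?thesis using xc by simp
      qed
      thus ?thesis using subspace_0[OF J0(1)] span_zero by auto
    qed
    have "(\<Sum>F\<in>{F \<in> through I J0. v \<in> F}. f F) = mobius_coeff b * up f (span (span (insert v I) \<union> J0))"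
      using IH[OF subspace_span disj] d Suc.prems(4) Suc.hyps(2) through_span_insert[OF Suc.prems(1)] by simp
    also have "span (span (insert v I) \<union> J0) = span (I \<union> J)"
    proof (rule subspace_dim_equal)
      have "span (insert v I) \<subseteq> span (I \<union> J)" using v by (intro span_mono) auto
      moreover have "J0 \<subseteq> span (I \<union> J)" using J0(2) span_superset by blast
      ultimately show "span (span (insert v I) \<union> J0) \<subseteq> span (I \<union> J)"
        by (intro span_minimal) auto
      show "dim (span (I \<union> J)) \<le> dim (span (span (insert v I) \<union> J0))"
        using dim_span_Un_disjoint[OF subspace_span J0(1) disj] dim_span_Un_disjoint[OF Suc.prems(1-3)]
          d J0 Suc.hyps(2) by simp
    qed auto
    finally show "(\<Sum>F\<in>{F \<in> through I J0. v \<in> F}. f F) = mobius_coeff b * up f (span (I \<union> J))" .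
  qed
  moreover have "real (card (J - J0)) = (q - 1) * q ^ b"
  proof -
    have "real (card (J - J0)) = real (card J) - real (card J0)"
      using J0 finite_vectors by (subst card_Diff_subset) (auto simp: of_nat_diff card_mono)
    also have "\<dots> = q ^ Suc b - q ^ b"
      using card_subspace[OF Suc.prems(2)] card_subspace[OF J0(1)] J0 Suc.hyps(2) by simp
    finally show ?thesis by (simp add: algebra_simps)
  qed
  ultimately have "(q - 1) * (q ^ b * (mobius_coeff b * up f (span (I \<union> J)))) = (q - 1) * (- (\<Sum>F\<in>through I J. f F))"
    by (simp add: mult_ac)
  hence "q ^ b * (mobius_coeff b * up f (span (I \<union> J))) = - (\<Sum>F\<in>through I J. f F)"
    using q_ge_2 by (subst (asm) mult_left_cancel) auto
  thus ?case using Suc.hyps(2)[symmetric] by (simp add: mobius_coeff_def mult_ac)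
qed

definition eigenvalue :: "nat \<Rightarrow> real" where
  "eigenvalue j = through_count k j * mobius_coeff j"

text \<open>After exchanging sums, each \<open>S\<close> disjoint from \<open>J\<close> is counted
  \<open>through_count k j\<close> times and no other \<open>S\<close> is counted;
  \<open>sum_through_disjoint\<close> with \<open>I = {0}\<close> evaluates what is left.\<close>

lemma up_kneser:
  assumes ker: "\<And>i. i < j \<Longrightarrow> ker i f" and J: "J \<in> Gr scale j UNIV" and j: "j \<le> k"
  shows "up (kneser f) J = eigenvalue j * up f J"
proof -
  have sJ: "subspace J" "dim J = j" using J by (auto simp: mem_Gr)
  have "up (kneser f) J = (\<Sum>F\<in>through J {0}. \<Sum>S\<in>G. if S \<inter> F = {0} then f S else 0)"
    unfolding up_def kneser_eq ..
  also have "\<dots> = (\<Sum>S\<in>G. \<Sum>F\<in>through J {0}. if S \<inter> F = {0} then f S else 0)" by (rule sum.swap)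
  also have "\<dots> = (\<Sum>S\<in>G. if S \<inter> J = {0} then through_count k j * f S else 0)"
  proof (rule sum.cong[OF refl])
    fix S assume "S \<in> G"
    hence sS: "subspace S" "dim S = k" by (auto simp: mem_Gr)
    have "(\<Sum>F\<in>through J {0}. if S \<inter> F = {0} then f S else 0) =
      (\<Sum>F\<in>{F \<in> through J {0}. S \<inter> F = {0}}. f S)"
      by (rule sum.inter_filter[symmetric]) simp
    also have "{F \<in> through J {0}. S \<inter> F = {0}} = through J S"
      unfolding through_trivial by (auto simp: through_def Int_commute)
    finally have eq: "(\<Sum>F\<in>through J {0}. if S \<inter> F = {0} then f S else 0) = real (card (through J S)) * f S"
      by simp
    show "(\<Sum>F\<in>through J {0}. if S \<inter> F = {0} then f S else 0) =
        (if S \<inter> J = {0} then through_count k j * f S else 0)"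
    proof (cases "S \<inter> J = {0}")
      case True
      thus ?thesis using eq card_through[OF sJ(1) sS(1)] sJ sS j by (simp add: Int_commute)
    next
      case False
      hence "through J S = {}"
        using subspace_0[OF sS(1)] subspace_0[OF sJ(1)] by (auto simp: through_def)
      hence "real (card (through J S)) = 0" by simp
      thus ?thesis using eq False by simp
    qed
  qed
  also have "\<dots> = through_count k j * (\<Sum>S\<in>through {0} J. f S)"
  proof -
    have "kneser f J = (\<Sum>S\<in>G. if S \<inter> J = {0} then f S else 0)" by (rule kneser_eq)
    thus ?thesis by (simp add: kneser_def[symmetric] sum_distrib_left if_distrib cong: if_cong)
  qed
  also have "(\<Sum>S\<in>through {0} J. f S) = mobius_coeff j * up f (span ({0} \<union> J))"
    using sum_through_disjoint[of j f "{0}" J] ker sJ subspace_0[OF sJ(1)] by simp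
  also have "span ({0} \<union> J) = J" using sJ(1) by (simp add: span_id)
  finally show ?thesis by (simp add: eigenvalue_def)
qed

lemma ker_kneser:
  assumes "ker j f" "j \<le> k"
  shows "ker j (kneser f)"
  unfolding ker_def
proof
  fix J assume J: "J \<in> Gr scale j UNIV"
  have "up (kneser f) J = eigenvalue j * up f J"
    using assms J by (intro up_kneser) (auto intro: ker_le)
  thus "up (kneser f) J = 0" using assms(1) J by (simp add: ker_def)
qed

section \<open>Orthogonal decomposition into eigenspaces\<close>

text \<open>\<open>g\<close> is the orthogonal projection of \<open>f\<close> to
  \<open>ker j\<close>. The remainder \<open>p\<close> is a combination of the indicators of
  containing a given \<open>j\<close>-space, and inner products with these are values of
  \<open>up\<close>.\<close>

lemma ker_split:
  assumes ker: "\<And>i. i < j \<Longrightarrow> ker i f" and j: "j \<le> k"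
  obtains g p where "f = (\<lambda>S. g S + p S)" "ker j g" "\<And>i. i < j \<Longrightarrow> ker i p"
    "\<And>g'. ker j g' \<Longrightarrow> ip g' p = 0"
proof -
  define w :: "'v set \<Rightarrow> 'v set \<Rightarrow> real" where "w J S = (if J \<subseteq> S then 1 else 0)" for J S
  have w: "(\<Sum>S\<in>G. g S * w J S) = up g J" for g J
    unfolding up_eq w_def by (intro sum.cong) auto
  obtain g h where gh: "\<And>S. f S = g S + (\<Sum>J\<in>Gr scale j UNIV. h J * w J S)"
    "\<And>J. J \<in> Gr scale j UNIV \<Longrightarrow> up g J = 0"
    using orthogonal_split[of "Gr scale j UNIV" f w G] unfolding w by auto
  define p where "p S = (\<Sum>J\<in>Gr scale j UNIV. h J * w J S)" for S
  have g: "ker j g" using gh(2) by (simp add: ker_def)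
  have f: "f = (\<lambda>S. g S + p S)" using gh(1) by (auto simp: p_def)
  show thesis
  proof (rule that[OF f g])
    fix i assume i: "i < j"
    show "ker i p"
      unfolding ker_def
    proof
      fix I assume I: "I \<in> Gr scale i UNIV"
      have "up f I = up g I + up p I" unfolding f by (rule up_add)
      moreover have "up f I = 0" "up g I = 0"
        using ker[OF i] ker_le[OF g less_imp_le[OF i] j] I by (auto simp: ker_def)
      ultimately show "up p I = 0" by simp
    qed
  next
    fix g' assume g': "ker j g'"
    have "ip g' p = (\<Sum>J\<in>Gr scale j UNIV. h J * (\<Sum>S\<in>G. g' S * w J S))"
      unfolding ip_def p_def sum_distrib_left by (subst sum.swap) (simp add: mult_ac)
    also have "\<dots> = 0" unfolding w using g' by (simp add: ker_def)
    finally show "ip g' p = 0" .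
  qed
qed

text \<open>The difference of \<open>r\<close> and \<open>c * p\<close> lies in \<open>ker j\<close>
  and is orthogonal to \<open>ker j\<close>, hence to itself.\<close>

lemma eigenvectorI:
  assumes "\<And>J. J \<in> Gr scale j UNIV \<Longrightarrow> up r J = c * up p J"
    and "\<And>g. ker j g \<Longrightarrow> ip g r = 0" "\<And>g. ker j g \<Longrightarrow> ip g p = 0"
  shows "S \<in> G \<Longrightarrow> r S = c * p S"
proof -
  define d where "d S = r S + (- c) * p S" for S
  have "up d J = up r J + (- c) * up p J" for J
    unfolding d_def by (simp only: up_add up_mult)
  hence "ker j d" using assms(1) by (simp add: ker_def)
  hence "ip d d = 0"
    using assms(2,3)[of d] unfolding d_def ip_add_right ip_mult_right by simp
  thus "S \<in> G \<Longrightarrow> r S = c * p S" using ip_self_eq_0[of d S] by (simp add: d_def)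
qed

text \<open>\<open>kneser\<close> is self-adjoint and preserves \<open>ker j\<close>, so it also
  preserves the orthogonality of \<open>p\<close> to \<open>ker j\<close>.\<close>

lemma kneser_eigenvector:
  assumes "\<And>i. i < j \<Longrightarrow> ker i p" "\<And>g. ker j g \<Longrightarrow> ip g p = 0" "j \<le> k" "S \<in> G"
  shows "kneser p S = eigenvalue j * p S"
proof (rule eigenvectorI[where j = j])
  show "up (kneser p) J = eigenvalue j * up p J" if "J \<in> Gr scale j UNIV" for J
    using assms that by (intro up_kneser)
  show "ip g (kneser p) = 0" if "ker j g" for g
    unfolding ip_kneser using assms(2)[OF ker_kneser[OF that assms(3)]] .
qed (use assms in auto)

lemma ip_kneser_split:
  assumes g: "ker j g" and p: "\<And>i. i < j \<Longrightarrow> ker i p" "\<And>g. ker j g \<Longrightarrow> ip g p = 0" and j: "j \<le> k"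
  shows "ip (\<lambda>S. g S + p S) (kneser (\<lambda>S. g S + p S)) = ip g (kneser g) + eigenvalue j * ip p p"
    and "ip (\<lambda>S. g S + p S) (\<lambda>S. g S + p S) = ip g g + ip p p"
proof -
  have K: "kneser (\<lambda>S. g S + p S) = (\<lambda>S. kneser g S + kneser p S)" by (rule ext) (rule kneser_add)
  have 1: "ip g (kneser p) = 0" unfolding ip_kneser using p(2)[OF ker_kneser[OF g j]] .
  have 2: "ip p (kneser g) = 0" unfolding ip_kneser using 1 by (simp add: ip_commute)
  have "ip p (kneser p) = ip p (\<lambda>S. eigenvalue j * p S)"
    using kneser_eigenvector[OF p j] by (intro ip_cong) auto
  thus "ip (\<lambda>S. g S + p S) (kneser (\<lambda>S. g S + p S)) = ip g (kneser g) + eigenvalue j * ip p p"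
    unfolding K ip_add_left ip_add_right using 1 2 by (simp add: ip_mult_right)
  show "ip (\<lambda>S. g S + p S) (\<lambda>S. g S + p S) = ip g g + ip p p"
    unfolding ip_add_left ip_add_right using p(2)[OF g] by (simp add: ip_commute)
qed

lemma ker_k_zero: "ker k f \<Longrightarrow> S \<in> G \<Longrightarrow> f S = 0"
proof -
  assume f: "ker k f" and S: "S \<in> G"
  have "F = S" if "F \<in> through S {0}" for F
    using subspace_dim_equal[of S F] that S by (simp add: through_def mem_Gr)
  hence "through S {0} = {S}" using S by (auto simp: through_trivial)
  thus "f S = 0" using f S by (auto simp: ker_def up_def)
qed

text \<open>Splits off one eigencomponent at a time. The induction ends at \<open>Suc k\<close>,
  where membership in \<open>ker k\<close> makes the function vanish on all
  \<open>k\<close>-spaces.\<close>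

lemma ip_kneser_ge:
  assumes \<rho>: "\<And>i. m \<le> i \<Longrightarrow> i \<le> k \<Longrightarrow> - \<rho> \<le> eigenvalue i" and "m \<le> j" "j \<le> Suc k"
    and "\<And>i. i < j \<Longrightarrow> ker i f"
  shows "- \<rho> * ip f f \<le> ip f (kneser f)"
  using assms(3,2,4)
proof (induction arbitrary: f rule: inc_induct)
  case base
  hence z: "f S = 0" if "S \<in> G" for S using ker_k_zero that by blast
  have "ip f f = 0" "ip f (kneser f) = 0" using z by (simp_all add: ip_def)
  thus ?case by simp
next
  case (step j)
  have j: "j \<le> k" using step.hyps by simp
  obtain g p where gp: "f = (\<lambda>S. g S + p S)" "ker j g" "\<And>i. i < j \<Longrightarrow> ker i p"
    "\<And>g'. ker j g' \<Longrightarrow> ip g' p = 0"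
    using ker_split[of j f] step.prems(2) j by blast
  have "- \<rho> * ip g g \<le> ip g (kneser g)"
    using step.prems(1) ker_le[OF gp(2) _ j] by (intro step.IH) auto
  moreover have "- \<rho> * ip p p \<le> eigenvalue j * ip p p"
    using \<rho>[OF step.prems(1) j] ip_self_nonneg by (intro mult_right_mono)
  moreover have "ip f (kneser f) = ip g (kneser g) + eigenvalue j * ip p p" "ip f f = ip g g + ip p p"
    unfolding gp(1) using ip_kneser_split[OF gp(2-4) j] by auto
  ultimately show ?case by (simp add: algebra_simps)
qed

text \<open>The absolute values decrease by a factor of at least \<open>3\<close> per step: the
  ratio is at most \<open>q ^ (k + j) / (q ^ n - q ^ (k + j))\<close>, and
  \<open>q ^ n \<ge> 4 * q ^ (k + j)\<close> when \<open>j < k\<close> and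
  \<open>n \<ge> 2 * k + 1\<close>.\<close>

lemma eigenvalue_ge:
  assumes n: "2 * k + 1 \<le> n" and j: "2 \<le> j" "j \<le> k"
  shows "- (through_count k 1 / 3) \<le> eigenvalue j"
proof -
  define a where "a j = through_count k j * (\<Prod>i<j. q ^ i)" for j
  have q: "q \<ge> 2" by (rule q_ge_2)
  have a0: "a j \<ge> 0" for j using through_count_pos[of k j] n q by (auto simp: a_def intro!: mult_nonneg_nonneg prod_nonneg)
  have step: "3 * a (Suc j) \<le> a j" if j: "j < k" for j
  proof -
    have "4 * q ^ (k + j) \<le> q ^ 2 * q ^ (k + j)"
      using q power_mono[of 2 q 2] by (intro mult_right_mono) auto
    also have "\<dots> \<le> q ^ n" using q_power_le[of "2 + (k + j)" n] j n by (simp flip: power_add)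
    finally have n4: "4 * q ^ (k + j) \<le> q ^ n" .
    have "q ^ (k + j) > 0" "q ^ j > 0" using q by auto
    have "a (Suc j) * (q ^ n - q ^ (j + k)) = q ^ j * (q ^ k - q ^ j) * a j"
      using through_count_Suc[OF j, of k] by (simp add: a_def mult_ac)
    also have "\<dots> \<le> q ^ (k + j) * a j"
      using \<open>q ^ j > 0\<close> a0 by (intro mult_right_mono) (simp_all add: power_add algebra_simps)
    finally have "a (Suc j) * (q ^ n - q ^ (j + k)) \<le> q ^ (k + j) * a j" .
    moreover have "a (Suc j) * (3 * q ^ (k + j)) \<le> a (Suc j) * (q ^ n - q ^ (j + k))"
      using n4 a0 by (intro mult_left_mono) (auto simp: add.commute)
    ultimately have "q ^ (k + j) * (3 * a (Suc j)) \<le> q ^ (k + j) * a j" by (simp add: mult_ac)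
    thus ?thesis using \<open>q ^ (k + j) > 0\<close> by (simp add: mult_le_cancel_left_pos)
  qed
  have "3 * a j \<le> a 1"
    using j
  proof (induction j rule: dec_induct)
    case base
    thus ?case using step[of 1] j by (simp add: numeral_2_eq_2)
  next
    case (step m)
    thus ?case using \<open>\<And>j. j < k \<Longrightarrow> 3 * a (Suc j) \<le> a j\<close>[of m] a0[of "Suc m"] by simp
  qed
  moreover have "a 1 = through_count k 1" by (simp add: a_def)
  moreover have "\<bar>eigenvalue j\<bar> = a j"
  proof -
    have "\<bar>mobius_coeff j\<bar> = (\<Prod>i<j. q ^ i)" using q by (simp add: mobius_coeff_def abs_prod)
    thus ?thesis using through_count_pos[of k j] n by (simp add: eigenvalue_def abs_mult a_def)
  qed
  ultimately show ?thesis by linarith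
qed

section \<open>The operator of degree sums\<close>

definition vup :: "('v set \<Rightarrow> real) \<Rightarrow> 'v \<Rightarrow> real" where
  "vup f v = (\<Sum>S\<in>{S \<in> G. v \<in> S}. f S)"

text \<open>The incidence operator to vectors followed by its transpose. For the indicator of a
  family it is the degree sum of \<open>S\<close> that the Ore condition bounds.\<close>

definition weight :: "('v set \<Rightarrow> real) \<Rightarrow> 'v set \<Rightarrow> real" where
  "weight f S = (\<Sum>v\<in>S - {0}. vup f v)"

lemma vup_eq: "vup f v = up f (span {v})"
proof -
  have "{S \<in> G. v \<in> S} = {S \<in> G. span {v} \<subseteq> S}" using span_singleton_subset_iff mem_Gr by blast
  thus ?thesis by (simp add: vup_def up_def through_trivial)
qed

lemma sum_vup_mult: "(\<Sum>v\<in>Z. c v * vup f v) = (\<Sum>S\<in>G. (\<Sum>v\<in>Z \<inter> S. c v) * f S)"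
proof -
  have "(\<Sum>v\<in>Z. c v * vup f v) = (\<Sum>v\<in>Z. \<Sum>S\<in>G. if v \<in> S then c v * f S else 0)"
    unfolding vup_def sum_distrib_left by (rule sum.cong[OF refl], rule sum.inter_filter) simp
  also have "\<dots> = (\<Sum>S\<in>G. \<Sum>v\<in>Z. if v \<in> S then c v * f S else 0)" by (rule sum.swap)
  also have "\<dots> = (\<Sum>S\<in>G. \<Sum>v\<in>Z \<inter> S. c v * f S)"
    by (rule sum.cong[OF refl], rule sum.inter_restrict[symmetric]) (rule finite_vectors)
  finally show ?thesis by (simp add: sum_distrib_right)
qed

lemma ip_weight: "ip g (weight f) = (\<Sum>v\<in>-{0}. vup g v * vup f v)"
proof -
  have "(\<Sum>v\<in>-{0}. vup f v * vup g v) = (\<Sum>S\<in>G. weight f S * g S)"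
    unfolding sum_vup_mult weight_def by (simp add: Int_commute Diff_eq)
  thus ?thesis by (simp add: ip_def mult.commute)
qed

lemma ker_0_iff: "ker 0 f \<longleftrightarrow> (\<Sum>S\<in>G. f S) = 0"
proof -
  have "Gr scale 0 UNIV = {{0}}" using subspace_0 by (auto simp: mem_Gr)
  moreover have "through {0} {0} = G" unfolding through_trivial by (auto simp: mem_Gr subspace_0)
  ultimately show ?thesis by (simp add: ker_def up_def)
qed

lemma sum_vup: "(\<Sum>v\<in>-{0}. vup f v) = (q ^ k - 1) * (\<Sum>S\<in>G. f S)"
proof -
  have "(\<Sum>v\<in>-{0}. 1 * vup f v) = (\<Sum>S\<in>G. (q ^ k - 1) * f S)"
    unfolding sum_vup_mult
    by (intro sum.cong) (auto simp: mem_Gr Int_commute[of "-{0}"] card_nonzero simp flip: Diff_eq)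
  thus ?thesis by (simp add: sum_distrib_left)
qed

text \<open>Both sides count the \<open>k\<close>-spaces that contain \<open>u\<close> but not
  \<open>v\<close>, for independent vectors \<open>u\<close> and \<open>v\<close>.\<close>

lemma through_count_1_1:
  assumes "2 \<le> k" "2 \<le> n"
  shows "through_count 1 1 = through_count 0 1 - through_count 0 2"
proof -
  have "dim (UNIV :: 'v set) > dim {0 :: 'v}" using dim_UNIV_eq assms by simp
  then obtain v :: 'v where v: "v \<noteq> 0" by (metis UNIV_eq_I insertCI less_irrefl)
  have "dim (UNIV :: 'v set) > dim (span {v})" using dim_UNIV_eq assms v by simp
  hence "span {v} \<noteq> UNIV" by (metis less_irrefl)
  then obtain u where u: "u \<notin> span {v}" by blast
  have disj: "span {u} \<inter> span {v} = {0}" using span_singleton_Int[OF subspace_span u] .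
  have u0: "u \<noteq> 0" using u span_zero by auto
  have v': "v \<notin> span {u}" using disj v span_base[of v "{v}"] by auto
  let ?A = "{F \<in> G. u \<in> F}" and ?B = "{F \<in> G. u \<in> F \<and> v \<in> F}"
  have "through (span {u}) (span {v}) = ?A - ?B"
  proof (rule set_eqI, rule iffI)
    fix F assume F: "F \<in> through (span {u}) (span {v})"
    have "v \<in> F \<Longrightarrow> v \<in> F \<inter> span {v}" by (simp add: span_base)
    hence "v \<notin> F" using F v by (auto simp: through_def)
    thus "F \<in> ?A - ?B" using F span_base[of u "{u}"] by (auto simp: through_def)
  next
    fix F assume "F \<in> ?A - ?B"
    hence F: "F \<in> G" "u \<in> F" "v \<notin> F" by auto
    hence "subspace F" by (simp add: mem_Gr)
    thus "F \<in> through (span {u}) (span {v})"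
      using F span_singleton_subset_iff[of F u] span_singleton_Int[of F v]
      by (simp add: through_def Int_commute)
  qed
  hence "real (card (through (span {u}) (span {v}))) = real (card ?A) - real (card ?B)"
    by (simp add: card_Diff_subset of_nat_diff card_mono Collect_mono)
  moreover have "real (card ?A) = through_count 0 1" using deg_Gr[OF u0] assms by (simp add: deg_def)
  moreover have "real (card ?B) = through_count 0 2" using card_containing_2[OF u0 v'] assms by simp
  moreover have "real (card (through (span {u}) (span {v}))) = through_count 1 1"
    using card_through[of "span {u}" "span {v}"] disj u0 v assms by simp
  ultimately show ?thesis by simp
qed

text \<open>Together with \<open>u\<close>, a vector \<open>v\<close> independent of
  \<open>u\<close> lies in \<open>through_count 0 2\<close> of the \<open>k\<close>-spaces, and one
  in the point of \<open>u\<close> in \<open>through_count 1 1\<close> more. The constant part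
  vanishes as \<open>p\<close> has sum \<open>0\<close>, which leaves the \<open>q - 1\<close>
  nonzero vectors of the point.\<close>

lemma weight_eigenvector:
  assumes p: "ker 0 p" "\<And>g. ker 1 g \<Longrightarrow> ip g p = 0" and k: "2 \<le> k" "2 \<le> n" and S: "S \<in> G"
  shows "weight p S = (q - 1) * through_count 1 1 * p S"
proof (rule eigenvectorI[where j = 1, OF _ _ p(2) S])
  fix J assume J: "J \<in> Gr scale 1 UNIV"
  have "\<not> J \<subseteq> {0}" using J by (simp add: mem_Gr flip: dim_eq_0)
  then obtain u where u: "u \<in> J" "u \<noteq> 0" by blast
  have "span {u} \<subseteq> J" using J u span_singleton_subset_iff by (simp add: mem_Gr)
  hence Ju: "J = span {u}" using J u subspace_dim_equal[of "span {u}" J] by (simp add: mem_Gr)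
  have "up (weight p) J = (\<Sum>S\<in>{S \<in> G. u \<in> S}. \<Sum>v\<in>S \<inter> -{0}. vup p v)"
    unfolding Ju vup_eq[symmetric] by (simp add: vup_def weight_def Diff_eq)
  also have "\<dots> = (\<Sum>v\<in>-{0}. vup p v * deg {S \<in> G. u \<in> S} v)" by (rule sum_members_vectors)
  also have "\<dots> = (\<Sum>v\<in>-{0}. through_count 0 2 * vup p v + (if v \<in> span {u} then through_count 1 1 * vup p u else 0))"
  proof (rule sum.cong[OF refl])
    fix v :: 'v assume v: "v \<in> -{0}"
    have eq: "deg {S \<in> G. u \<in> S} v = real (card {F \<in> G. u \<in> F \<and> v \<in> F})"
      unfolding deg_def by (rule arg_cong[where f = "\<lambda>X. real (card X)"]) auto
    show "vup p v * deg {S \<in> G. u \<in> S} v = through_count 0 2 * vup p v + (if v \<in> span {u} then through_count 1 1 * vup p u else 0)"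
    proof (cases "v \<in> span {u}")
      case False
      thus ?thesis using eq card_containing_2[OF u(2) False k(1)] by simp
    next
      case True
      have "span {v} \<subseteq> span {u}" using True by (simp add: span_singleton_subset_iff)
      hence "span {v} = span {u}" using u v subspace_dim_equal[of "span {v}" "span {u}"] by simp
      hence uv: "v \<in> F \<longleftrightarrow> u \<in> F" if "subspace F" for F
        using that span_singleton_subset_iff by metis
      hence "{F \<in> G. u \<in> F \<and> v \<in> F} = {F \<in> G. u \<in> F}" "{F \<in> G. v \<in> F} = {F \<in> G. u \<in> F}"
        by (auto simp: mem_Gr)
      moreover have "real (card {F \<in> G. u \<in> F}) = through_count 0 1"
        using deg_Gr[OF u(2)] k by (simp add: deg_def)
      ultimately have "deg {S \<in> G. u \<in> S} v = through_count 0 1" "vup p v = vup p u"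
        using eq by (simp_all add: vup_def)
      moreover have "through_count 0 1 = through_count 0 2 + through_count 1 1" using through_count_1_1[OF k] by simp
      ultimately show ?thesis using True by (simp add: distrib_left mult.commute)
    qed
  qed
  also have "\<dots> = through_count 0 2 * (\<Sum>v\<in>-{0}. vup p v) + (\<Sum>v\<in>-{0}. if v \<in> span {u} then through_count 1 1 * vup p u else 0)"
    by (simp add: sum.distrib sum_distrib_left)
  also have "(\<Sum>v\<in>-{0}. vup p v) = 0" using p(1) sum_vup by (simp add: ker_0_iff)
  also have "(\<Sum>v\<in>-{0}. if v \<in> span {u} then through_count 1 1 * vup p u else 0) =
      (\<Sum>v\<in>-{0} \<inter> span {u}. through_count 1 1 * vup p u)"
    by (rule sum.inter_restrict[symmetric]) (rule finite_vectors)
  also have "\<dots> = real (card (span {u} - {0})) * (through_count 1 1 * vup p u)"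
    by (simp add: Diff_eq Int_commute)
  also have "real (card (span {u} - {0})) = q - 1" using card_nonzero[of "span {u}"] u by simp
  finally show "up (weight p) J = (q - 1) * through_count 1 1 * up p J"
    by (simp add: Ju vup_eq)
next
  fix g assume g: "ker 1 g"
  have "vup g v = 0" if "v \<in> -{0}" for v
    using g that by (simp add: vup_eq ker_def mem_Gr)
  thus "ip g (weight p) = 0" unfolding ip_weight by simp
qed auto

section \<open>The case \<open>M = 1\<close>: intersecting families\<close>

text \<open>Two inequalities for the normalised square norm \<open>\<phi>\<close> of
  \<open>p\<close> contradict each other: \<open>A1\<close>, from intersection and the eigenvalue
  bounds, is a lower bound, and \<open>A2\<close>, from the Ore condition through the second moment
  of the degrees, an upper bound.\<close>

lemma matching_exists_1:
  assumes \<A>: "\<A> \<subset> Gr scale k UNIV" and k: "2 \<le> k" and n: "2 * k + 1 \<le> n"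
    and s: "(q ^ k - 1) * (through_count 0 1 - through_count 1 1) < s"
    and \<sigma>: "\<And>S. S \<in> Gr scale k UNIV - \<A> \<Longrightarrow> s \<le> (\<Sum>v\<in>S - {0}. deg \<A> v)"
  shows "\<exists>F\<in>\<A>. \<exists>F'\<in>\<A>. F \<inter> F' = {0}"
proof (rule ccontr)
  assume no: "\<not> ?thesis"
  have q: "q \<ge> 2" by (rule q_ge_2)
  have n2: "2 \<le> n" using n k by simp
  define N P1 where "N = through_count 0 0" and "P1 = through_count 0 1"
  have pos: "N > 0" "P1 > 0" using through_count_pos[of 0] n by (auto simp: N_def P1_def)
  have NP: "N * (q ^ k - 1) = (q ^ n - 1) * P1" using card_Gr_mult k by (simp add: N_def P1_def)
  have qq: "q < q ^ k" "q ^ k < q ^ n" "q < q ^ n"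
    using q_power_less[of 1 k] q_power_less[of k n] q_power_less[of 1 n] k n by simp_all
  define f :: "'v set \<Rightarrow> real" where "f S = (if S \<in> \<A> then 1 else 0)" for S
  define m where "m = real (card \<A>)"
  define a where "a = m / N"
  have m: "m = a * N" using pos by (simp add: a_def)
  have sumG: "(\<Sum>S\<in>G. 1) = N" using card_Gr by (simp add: N_def)
  have sumf: "(\<Sum>S\<in>G. f S) = m"
  proof -
    have "G \<inter> \<A> = \<A>" using \<A> by auto
    thus ?thesis unfolding f_def m_def by (simp flip: sum.inter_restrict)
  qed
  have "0 < s"
  proof -
    have "through_count 0 2 > 0" using through_count_pos[of 0 2] n by simp
    hence "(q ^ k - 1) * (through_count 0 1 - through_count 1 1) > 0" using through_count_1_1[OF k n2] qq q by simp
    thus ?thesis using s by simp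
  qed
  have "\<A> \<noteq> {}"
  proof
    assume e: "\<A> = {}"
    then obtain S where "S \<in> G - \<A>" using \<A> by blast
    from \<sigma>[OF this] \<open>0 < s\<close> show False by (simp add: e deg_def)
  qed
  hence a0: "0 < a" using pos by (simp add: a_def m_def card_gt_0_iff)
  have "card \<A> < card G" using \<A> by (intro psubset_card_mono) auto
  hence "m < N" by (simp add: m_def N_def flip: card_Gr)
  hence a1: "a < 1" using pos by (simp add: a_def)
  \<comment> \<open>As \<open>a\<close> is the density of \<open>\<A>\<close>, \<open>g0\<close> has
    sum \<open>0\<close>, so it lies in \<open>ker 0\<close>.\<close>
  define g0 where "g0 S = f S + (- a)" for S
  have f_eq: "f = (\<lambda>S. g0 S + a)" by (auto simp: g0_def)
  have "(\<Sum>S\<in>G. g0 S) = m - a * N"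
    unfolding g0_def sum.distrib sumf using sumG by simp
  hence g0: "ker 0 g0" by (simp add: ker_0_iff m)
  obtain g p where gp: "g0 = (\<lambda>S. g S + p S)" "ker 1 g" "\<And>i. i < 1 \<Longrightarrow> ker i p"
    "\<And>g'. ker 1 g' \<Longrightarrow> ip g' p = 0"
    using ker_split[of 1 g0] g0 k by auto
  have p0: "ker 0 p" using gp(3) by simp
  define \<phi> where "\<phi> = ip p p / N"
  have phi: "ip p p = \<phi> * N" using pos by (simp add: \<phi>_def)
  have split: "ip g0 (kneser g0) = ip g (kneser g) + eigenvalue 1 * ip p p" "ip g0 g0 = ip g g + ip p p"
    unfolding gp(1) by (rule ip_kneser_split[OF gp(2-4)]; use k in simp)+
  have g0sum: "ip (\<lambda>S. c) g0 = 0" "ip g0 (\<lambda>S. c) = 0" for c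
    using g0 by (simp_all add: ip_def ker_0_iff flip: sum_distrib_left sum_distrib_right)
  have kc: "kneser (\<lambda>S. c) F = c * through_count k 0" if "F \<in> G" for c F
  proof -
    have "real (card (through {0} F)) = through_count k 0"
      using card_through[of "{0}" F] that subspace_0[of F] by (simp add: mem_Gr)
    thus ?thesis by (simp add: kneser_def)
  qed
  have const_const: "ip (\<lambda>S. c) (\<lambda>S. d) = c * d * N" for c d
    using sumG by (simp add: ip_def)
  have norm: "ip f f = ip g0 g0 + a\<^sup>2 * N"
    unfolding f_eq ip_add_left ip_add_right using g0sum by (simp add: const_const power2_eq_square)
  have "ip f f = m"
    unfolding sumf[symmetric] ip_def by (rule sum.cong) (simp_all add: f_def)
  hence norm': "a * N = ip g g + \<phi> * N + a\<^sup>2 * N"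
    using norm split(2) phi m by simp
  have "ip f (kneser f) = 0"
  proof -
    have "f F * kneser f F = 0" for F
      using no by (auto simp: f_def kneser_def through_def intro!: sum.neutral)
    thus ?thesis unfolding ip_def by (intro sum.neutral ballI)
  qed
  moreover have "ip f (kneser f) = ip g0 (kneser g0) + a\<^sup>2 * N * through_count k 0"
  proof -
    have K: "kneser f = (\<lambda>S. kneser g0 S + kneser (\<lambda>S. a) S)"
      unfolding f_eq by (rule ext) (rule kneser_add)
    have "ip h (kneser (\<lambda>S. a)) = ip h (\<lambda>S. a * through_count k 0)" for h
      by (rule ip_cong) (simp_all add: kc)
    moreover have "ip (\<lambda>S. a) (kneser g0) = ip (\<lambda>S. a * through_count k 0) g0"
      unfolding ip_kneser by (rule ip_cong) (simp_all add: kc)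
    moreover have "ip f (kneser f) = ip f (kneser g0) + ip f (kneser (\<lambda>S. a))"
      unfolding K by (rule ip_add_right)
    moreover have "ip f h = ip g0 h + ip (\<lambda>S. a) h" for h
      unfolding f_eq by (rule ip_add_left)
    ultimately show ?thesis
      using g0sum by (simp add: const_const power2_eq_square)
  qed
  moreover have "ip g0 (kneser g0) = ip g (kneser g) - through_count k 1 * (\<phi> * N)"
    using split(1) phi by (simp add: eigenvalue_def mobius_coeff_def)
  \<comment> \<open>\<open>g\<close> lies in \<open>ker 1\<close>, so only eigenvalues of index at
    least \<open>2\<close> contribute.\<close>
  moreover have "- (through_count k 1 / 3) * ip g g \<le> ip g (kneser g)"
  proof (rule ip_kneser_ge[of 2 _ 2])
    show "ker i g" if "i < 2" for i using ker_le[OF gp(2), of i] that k by simp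
  qed (use eigenvalue_ge[OF n] k in auto)
  ultimately have "a\<^sup>2 * N * through_count k 0 \<le> through_count k 1 * (\<phi> * N) + through_count k 1 / 3 * ip g g" by simp
  also have "ip g g = (a * (1 - a) - \<phi>) * N" using norm' by (simp add: power2_eq_square algebra_simps)
  finally have "N * (a\<^sup>2 * through_count k 0) \<le> N * (through_count k 1 * (\<phi> + (a * (1 - a) - \<phi>) / 3))"
  proof -
    have "N * (x * y) \<le> N * (z * (u + w / 3))" if "x * N * y \<le> z * (u * N) + z / 3 * (w * N)"
      for x y z u w :: real
      using that by (simp add: distrib_left mult_ac)
    thus "a\<^sup>2 * N * through_count k 0 \<le> through_count k 1 * (\<phi> * N) + through_count k 1 / 3 * ((a * (1 - a) - \<phi>) * N) \<Longrightarrow> ?thesis" .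
  qed
  hence A1: "a\<^sup>2 * through_count k 0 \<le> through_count k 1 * (\<phi> + (a * (1 - a) - \<phi>) / 3)" using pos by simp
  have \<phi>_le: "\<phi> \<le> a * (1 - a)"
  proof -
    have "\<phi> * N \<le> (a * (1 - a)) * N"
      using norm' ip_self_nonneg[of g] by (simp add: power2_eq_square algebra_simps)
    thus ?thesis using pos by simp
  qed
  \<comment> \<open>The degrees see only the constant part and \<open>p\<close>; the component
    \<open>g\<close> in \<open>ker 1\<close> sums to \<open>0\<close> through every point.\<close>
  have degv: "deg \<A> v = a * P1 + vup p v" if "v \<in> -{0}" for v
  proof -
    have "deg \<A> v = vup f v"
    proof -
      have "{S \<in> G. v \<in> S} \<inter> \<A> = {F \<in> \<A>. v \<in> F}" using \<A> by auto
      thus ?thesis unfolding vup_def f_def deg_def by (simp flip: sum.inter_restrict)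
    qed
    also have "\<dots> = vup g v + vup p v + vup (\<lambda>S. a) v"
      unfolding f_eq gp(1) by (simp add: vup_def sum.distrib)
    also have "vup g v = 0" using gp(2) that by (simp add: vup_eq ker_def mem_Gr)
    also have "vup (\<lambda>S. a) v = a * P1"
      using deg_Gr[of v] that k by (simp add: vup_def deg_def P1_def)
    finally show ?thesis by simp
  qed
  have "(\<Sum>v\<in>-{0}. (deg \<A> v)\<^sup>2) = (\<Sum>v\<in>-{0}. (a * P1)\<^sup>2 + (2 * a * P1 * vup p v + vup p v * vup p v))"
    by (rule sum.cong[OF refl]) (simp add: degv power2_eq_square algebra_simps)
  also have "\<dots> = (q ^ n - 1) * (a * P1)\<^sup>2 + (2 * a * P1 * (\<Sum>v\<in>-{0}. vup p v) + (\<Sum>v\<in>-{0}. vup p v * vup p v))"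
    using card_nonzero[of UNIV] dim_UNIV_eq
    by (simp add: sum.distrib sum_distrib_left Compl_eq_Diff_UNIV)
  also have "(\<Sum>v\<in>-{0}. vup p v) = 0" using p0 sum_vup by (simp add: ker_0_iff)
  also have "(\<Sum>v\<in>-{0}. vup p v * vup p v) = ip p (weight p)" by (rule ip_weight[symmetric])
  also have "ip p (weight p) = ip p (\<lambda>S. (q - 1) * through_count 1 1 * p S)"
    using weight_eigenvector[OF p0 gp(4) k n2] by (intro ip_cong) auto
  also have "\<dots> = (q - 1) * through_count 1 1 * (\<phi> * N)" by (simp only: ip_mult_right phi)
  finally have sq: "(\<Sum>v\<in>-{0}. (deg \<A> v)\<^sup>2) = a\<^sup>2 * P1 * (N * (q ^ k - 1)) + (q - 1) * through_count 1 1 * (\<phi> * N)"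
    by (simp add: NP power2_eq_square mult_ac)
  have "s * (N - m) \<le> P1 * (q ^ k - 1) * m - (\<Sum>v\<in>-{0}. (deg \<A> v)\<^sup>2)"
    unfolding N_def P1_def m_def using sum_deg_sq_bound[OF psubset_imp_subset[OF \<A>] _ \<sigma>] k by simp
  hence "N * (s * (1 - a)) \<le> N * (P1 * (q ^ k - 1) * (a * (1 - a)) - (q - 1) * through_count 1 1 * \<phi>)"
    unfolding sq m by (simp add: power2_eq_square algebra_simps)
  hence "s * (1 - a) \<le> P1 * (q ^ k - 1) * (a * (1 - a)) - (q - 1) * through_count 1 1 * \<phi>" using pos by simp
  moreover have "(q ^ k - 1) * (through_count 0 1 - through_count 1 1) * (1 - a) < s * (1 - a)"
    using s a1 by (intro mult_strict_right_mono) auto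
  moreover have "(q ^ k - 1) * (1 - a) * (P1 * a - through_count 0 2) =
      P1 * (q ^ k - 1) * (a * (1 - a)) - (q ^ k - 1) * through_count 0 2 * (1 - a)"
    by algebra
  moreover have "through_count 0 1 - through_count 1 1 = through_count 0 2" using through_count_1_1[OF k n2] by simp
  ultimately have A2: "(q - 1) * through_count 1 1 * \<phi> < (q ^ k - 1) * (1 - a) * (P1 * a - through_count 0 2)"
    by simp
  \<comment> \<open>The numbers of points of a \<open>k\<close>-space and of the whole space; in
    these terms the powers of \<open>q\<close> disappear from \<open>A1\<close> and
    \<open>A2\<close>.\<close>
  define K N' where "K = (q ^ k - 1) / (q - 1)" and "N' = (q ^ n - 1) / (q - 1)"
  have KN: "q ^ k - 1 = K * (q - 1)" "q ^ n - 1 = N' * (q - 1)" using q by (simp_all add: K_def N'_def)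
  have KN': "q ^ k - q = (K - 1) * (q - 1)" "q ^ n - q = (N' - 1) * (q - 1)" "q ^ n - q ^ k = (N' - K) * (q - 1)"
    using KN by (simp_all add: algebra_simps)
  have NK: "K < N'" using qq q by (simp add: K_def N'_def divide_strict_right_mono)
  have K3: "3 \<le> K"
  proof -
    have "(q - 1) * 3 \<le> (q - 1) * (q + 1)" using q by (intro mult_left_mono) auto
    also have "\<dots> \<le> q ^ k - 1" using q_power_le[OF k] by (simp add: power2_eq_square algebra_simps)
    finally show ?thesis using q by (simp add: K_def field_simps)
  qed
  have c02: "through_count 0 2 = P1 * ((K - 1) / (N' - 1))"
    using through_count_0_2[OF k n2] q by (simp add: P1_def KN')
  have c11: "through_count 1 1 = P1 * ((N' - K) / (N' - 1))"
    using through_count_1_1[OF k n2] c02 NK K3 by (simp add: P1_def field_simps)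
  have ck: "through_count k 0 * K = (N' - K) * through_count k 1"
  proof -
    have "through_count k 0 * (q ^ k - 1) = (q ^ n - q ^ k) * through_count k 1" using through_count_Suc[of 0 k] k by simp
    thus ?thesis using KN KN' q by simp
  qed
  have ck1: "through_count k 1 > 0" using through_count_pos n by simp
  show False
  proof (rule spectral_contradiction[OF K3 NK a0 a1 \<phi>_le])
    have "(q - 1) * (P1 / (N' - 1)) * (\<phi> * (N' - K)) <
          (q - 1) * (P1 / (N' - 1)) * ((1 - a) * K * ((N' - 1) * a - (K - 1)))"
    proof -
      have "(q - 1) * (P1 / (N' - 1)) * (\<phi> * (N' - K)) = (q - 1) * through_count 1 1 * \<phi>"
        unfolding c11 by simp
      also note A2
      also have "(q ^ k - 1) * (1 - a) * (P1 * a - through_count 0 2) =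
          (q - 1) * (P1 / (N' - 1)) * ((1 - a) * K * ((N' - 1) * a - (K - 1)))"
        unfolding KN c02 using NK K3 by (simp add: field_simps)
      finally show ?thesis .
    qed
    moreover have "(q - 1) * (P1 / (N' - 1)) > 0" using q pos NK K3 by simp
    ultimately show "\<phi> * (N' - K) < (1 - a) * K * ((N' - 1) * a - (K - 1))"
      by (simp only: mult_less_cancel_left_pos)
    have "through_count k 1 * (a\<^sup>2 * (N' - K)) = K * (a\<^sup>2 * through_count k 0)" using ck by (simp add: mult_ac)
    also have "\<dots> \<le> K * (through_count k 1 * (\<phi> + (a * (1 - a) - \<phi>) / 3))" using A1 K3 by (intro mult_left_mono) auto
    finally have "through_count k 1 * (a\<^sup>2 * (N' - K)) \<le> through_count k 1 * (K * (\<phi> + (a * (1 - a) - \<phi>) / 3))"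
      by (simp only: mult_ac)
    thus "a\<^sup>2 * (N' - K) \<le> K * (\<phi> + (a * (1 - a) - \<phi>) / 3)" using ck1 by simp
  qed
qed

end

section \<open>Colourings\<close>

lemma pigeonhole_colours:
  fixes a :: "nat \<Rightarrow> nat"
  assumes "finite J" "g \<in> J \<rightarrow> C" "finite C" "(\<Sum>i\<in>C. a i - 1) < card J"
  shows "\<exists>i\<in>C. a i \<le> card {j \<in> J. g j = i}"
proof (rule ccontr)
  assume "\<not> ?thesis"
  hence "(\<Sum>i\<in>C. card {j \<in> J. g j = i}) \<le> (\<Sum>i\<in>C. a i - 1)" by (intro sum_mono) force
  moreover have "(\<Sum>i\<in>C. card {j \<in> J. g j = i}) = card J"
    using sum.group[OF assms(1,3), of g "\<lambda>_. 1 :: nat"] assms(2) by (auto simp: Pi_iff image_subset_iff)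
  ultimately show False using assms(4) by simp
qed

context finite_vector_space
begin

section \<open>From the Ore hypothesis to a matching of size \<open>M + 1\<close>\<close>

lemma matching_exists:
  assumes \<A>: "\<A> \<subset> Gr scale k UNIV" and k: "2 \<le> k"
    and n0: "M = 0 \<Longrightarrow> k \<le> n" and n1: "M = 1 \<Longrightarrow> 2 * k + 1 \<le> n"
    and n2: "2 \<le> M \<Longrightarrow> (2 * M + 1) * k - M + 3 \<le> n"
    and \<sigma>: "gauss_binomial CARD('f) k 1 * (gauss_binomial CARD('f) (n - 1) (k - 1)
        - q ^ (M * (k - 1)) * gauss_binomial CARD('f) (n - M - 1) (k - 1))
      < real (ore_degree scale UNIV k \<A>)"
  shows "\<exists>U. matching \<A> (Suc M) U"
proof -
  have q: "q \<ge> 2" by (rule q_ge_2)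
  have \<A>': "\<A> \<subseteq> Gr scale k UNIV" using \<A> by blast
  have kM: "k + M \<le> n"
  proof -
    consider "M = 0" | "M = 1" | "2 \<le> M" by linarith
    thus ?thesis
    proof cases
      case 3
      have "M * 2 \<le> M * k" using k by (rule mult_le_mono2)
      moreover have "(2 * M + 1) * k = 2 * (M * k) + k" by (simp add: algebra_simps)
      ultimately show ?thesis using n2[OF 3] by linarith
    qed (use n0 n1 k in auto)
  qed
  define s where "s = (q - 1) * real (ore_degree scale UNIV k \<A>)"
  have \<sigma>_le: "s \<le> (\<Sum>v\<in>S - {0}. deg \<A> v)" if "S \<in> Gr scale k UNIV - \<A>" for S
    unfolding s_def using ore_degree_le[OF \<A>' that] .
  have s: "(q ^ k - 1) * (through_count 0 1 - through_count M 1) < s"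
  proof -
    have "gauss_binomial CARD('f) k 1 = (q ^ k - 1) / (q - 1)"
      using k by (simp add: gauss_binomial_def q_eq)
    moreover have "through_count 0 1 = gauss_binomial CARD('f) (n - 1) (k - 1)"
      using through_count_gauss[of 0 1] kM k by simp
    moreover have "through_count M 1 = q ^ (M * (k - 1)) * gauss_binomial CARD('f) (n - M - 1) (k - 1)"
      using through_count_gauss[of M 1] kM k by simp
    ultimately have "(q ^ k - 1) / (q - 1) * (through_count 0 1 - through_count M 1) < real (ore_degree scale UNIV k \<A>)"
      using \<sigma> by simp
    thus ?thesis unfolding s_def using q by (simp add: field_simps)
  qed
  have single: "matching \<A> (Suc 0) F" if F: "F \<in> \<A>" for F
  proof -
    have sF: "subspace F" using F \<A>' by (auto simp: mem_Gr)
    have "matching \<A> (Suc 0) (span ({0} \<union> F))"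
      using F \<A>' subspace_0[OF sF] by (intro matching_Suc[OF matching_0]) auto
    moreover have "span ({0} \<union> F) = F" using sF by (simp add: span_id)
    ultimately show ?thesis by (simp only:)
  qed
  consider "M = 0" | "M = 1" | "2 \<le> M" by linarith
  thus ?thesis
  proof cases
    case 1
    \<comment> \<open>For \<open>M = 0\<close> the threshold is \<open>0\<close>, so the Ore
      condition says that the degree sums are positive.\<close>
    have "\<A> \<noteq> {}"
    proof
      assume e: "\<A> = {}"
      then obtain S where "S \<in> Gr scale k UNIV - \<A>" using \<A> by blast
      from \<sigma>_le[OF this] s 1 show False by (simp add: e deg_def)
    qed
    thus ?thesis using single 1 by auto
  next
    case 2
    obtain F F' where F: "F \<in> \<A>" "F' \<in> \<A>" "F \<inter> F' = {0}"
      using matching_exists_1[OF \<A> k n1[OF 2] s[unfolded 2] \<sigma>_le] by blast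
    have "matching \<A> (Suc (Suc 0)) (span (F' \<union> F))"
      using matching_Suc[OF single[OF F(2)] \<A>' F(1,3)] .
    thus ?thesis using 2 by auto
  next
    case 3
    thus ?thesis using matching_exists_ge_2[OF \<A> k 3 n2[OF 3] s \<sigma>_le] by blast
  qed
qed

section \<open>Subfamilies of direct families\<close>

lemma dim_sum_family_le:
  assumes "finite I" "\<And>j. j \<in> I \<Longrightarrow> Fs j \<in> Gr scale k UNIV"
  shows "dim (\<Sum>j\<in>I. Fs j) \<le> card I * k"
  using assms
proof (induction I rule: finite_induct)
  case (insert i I)
  have "subspace (Fs i)" "dim (Fs i) = k" using insert.prems by (auto simp: mem_Gr)
  moreover have "subspace (\<Sum>j\<in>I. Fs j)"
    using insert by (intro subspace_sum_family) (auto simp: mem_Gr)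
  ultimately have "dim (Fs i + (\<Sum>j\<in>I. Fs j)) \<le> k + dim (\<Sum>j\<in>I. Fs j)"
    using dim_span_Un[of "Fs i" "\<Sum>j\<in>I. Fs j"] by (simp add: subspace_sum_eq_span)
  thus ?case using insert by auto
qed (simp add: set_zero)

text \<open>The members outside \<open>I\<close> contribute at most \<open>card (J - I) * k\<close>
  to the full dimension, so those in \<open>I\<close> must contribute the rest.\<close>

lemma dim_subfamily:
  assumes "\<And>j. j \<in> J \<Longrightarrow> Fs j \<in> Gr scale k UNIV" and J: "finite J" "dim (\<Sum>j\<in>J. Fs j) = card J * k"
    and I: "I \<subseteq> J"
  shows "dim (\<Sum>j\<in>I. Fs j) = card I * k"
proof -
  have fin: "finite I" "finite (J - I)" using I J(1) by (auto intro: finite_subset)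
  have s: "subspace (\<Sum>j\<in>I. Fs j)" "subspace (\<Sum>j\<in>J - I. Fs j)"
    using assms(1) I fin by (auto intro!: subspace_sum_family simp: mem_Gr)
  have "(\<Sum>j\<in>J. Fs j) = (\<Sum>j\<in>J - I. Fs j) + (\<Sum>j\<in>I. Fs j)" using I J(1) by (rule sum.subset_diff)
  also have "dim \<dots> \<le> dim (\<Sum>j\<in>J - I. Fs j) + dim (\<Sum>j\<in>I. Fs j)"
    using dim_span_Un[OF s(2,1)] s by (simp add: subspace_sum_eq_span)
  finally have "card J * k \<le> dim (\<Sum>j\<in>J - I. Fs j) + dim (\<Sum>j\<in>I. Fs j)" using J(2) by simp
  moreover have "dim (\<Sum>j\<in>J - I. Fs j) \<le> card (J - I) * k" "dim (\<Sum>j\<in>I. Fs j) \<le> card I * k"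
    using assms(1) I fin by (auto intro!: dim_sum_family_le)
  moreover have "card J = card (J - I) + card I"
    using I J(1) by (simp add: card_Diff_subset fin card_mono)
  ultimately show ?thesis by (simp add: add_mult_distrib)
qed

end

theorem corollary1p4:
  fixes scale :: "'f::{field,finite} \<Rightarrow> 'v::ab_group_add \<Rightarrow> 'v"
    and q k c n M :: nat
    and a :: "nat \<Rightarrow> nat"
    and \<F> :: "'v set set"
    and \<chi> :: "'v set \<Rightarrow> nat"
  assumes "q = CARD('f)"
    and "k \<ge> 2"
    and "c \<ge> 1"
    and "\<forall>i\<in>{1..c}. a i \<ge> 1"
    and "M = (\<Sum>i=1..c. a i - 1)"
    and "M = 0 \<Longrightarrow> n \<ge> k"
    and "M = 1 \<Longrightarrow> n \<ge> 2 * k + 1"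
    and "M \<ge> 2 \<Longrightarrow> n \<ge> (2 * M + 1) * k - M + 3"
    and "vector_space scale"
    and "vector_space.dim scale (UNIV :: 'v set) = n"
    and "\<F> \<subset> Gr scale k UNIV"
    and "real (ore_degree scale UNIV k \<F>) >
           gauss_binomial q k 1 *
             (gauss_binomial q (n - 1) (k - 1)
              - real q ^ (M * (k - 1)) * gauss_binomial q (n - M - 1) (k - 1))"
    and "\<chi> \<in> \<F> \<rightarrow> {1..c}"
  shows "\<exists>i\<in>{1..c}. \<exists>Fs. direct_sum_matching scale k \<F> (a i) Fs \<and> monochromatic \<chi> i (a i) Fs"
proof -
  interpret vector_space scale by fact
  \<comment> \<open>\<open>dim\<close> is \<open>0\<close> on infinite-dimensional spaces, so finite
    dimension is deduced from \<open>n\<close> being positive.\<close>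
  have "n \<noteq> 0"
  proof -
    consider "M = 0" | "M = 1" | "2 \<le> M" by linarith
    thus ?thesis using assms(2,6-8) by cases auto
  qed
  obtain B :: "'v set" where B: "independent B" "UNIV \<subseteq> span B" "card B = dim (UNIV :: 'v set)"
    using basis_exists[of UNIV] by blast
  have "finite B" using B(3) assms(10) \<open>n \<noteq> 0\<close> by (intro card_ge_0_finite) simp
  interpret finite_vector_space scale B n k "real q"
    using B \<open>finite B\<close> assms(1,10) by unfold_locales auto
  obtain U where "matching \<F> (Suc M) U"
    using matching_exists[OF assms(11,2,6,7,8)] assms(1,12) by auto
  then obtain Fs where Fs: "\<And>j. j \<in> {1..Suc M} \<Longrightarrow> Fs j \<in> \<F>" "dim (\<Sum>j=1..Suc M. Fs j) = Suc M * k"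
    unfolding matching_def by blast
  have "\<exists>i\<in>{1..c}. a i \<le> card {j \<in> {1..Suc M}. \<chi> (Fs j) = i}"
  proof (rule pigeonhole_colours)
    show "(\<lambda>j. \<chi> (Fs j)) \<in> {1..Suc M} \<rightarrow> {1..c}" using assms(13) Fs(1) by (simp add: Pi_iff)
    show "(\<Sum>i\<in>{1..c}. a i - 1) < card {1..Suc M}" using assms(5) by simp
  qed auto
  \<comment> \<open>The colour class may be larger than required; exactly \<open>a i\<close> of its
    indices are kept and renumbered from \<open>1\<close> by \<open>h\<close>.\<close>
  then obtain i where i: "i \<in> {1..c}" "a i \<le> card {j \<in> {1..Suc M}. \<chi> (Fs j) = i}" by blast
  then obtain I where I: "I \<subseteq> {j \<in> {1..Suc M}. \<chi> (Fs j) = i}" "card I = a i" "finite I"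
    using obtain_subset_with_card_n[OF i(2)] by blast
  obtain h where h: "bij_betw h {1..a i} I"
    using ex_bij_betw_nat_finite_1[OF I(3)] I(2) by auto
  have hI: "Fs (h j) \<in> \<F>" "\<chi> (Fs (h j)) = i" if "j \<in> {1..a i}" for j
    using bij_betwE[OF h] that I(1) Fs(1)[of "h j"] by blast+
  have "(\<Sum>j=1..a i. Fs (h j)) = (\<Sum>j\<in>I. Fs j)" by (rule sum.reindex_bij_betw[OF h])
  moreover have "dim (\<Sum>j\<in>I. Fs j) = card I * k"
  proof (rule dim_subfamily)
    show "Fs j \<in> Gr scale k UNIV" if "j \<in> {1..Suc M}" for j using Fs(1)[OF that] assms(11) by blast
    have c: "card {1..Suc M} = Suc M" by simp
    show "dim (\<Sum>j\<in>{1..Suc M}. Fs j) = card {1..Suc M} * k" unfolding c by (rule Fs(2))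
  qed (use I(1) in auto)
  ultimately have "direct_sum_matching scale k \<F> (a i) (Fs \<circ> h)"
    using hI(1) I(2) by (auto simp: direct_sum_matching_def)
  moreover have "monochromatic \<chi> i (a i) (Fs \<circ> h)"
    using hI(2) by (auto simp: monochromatic_def)
  ultimately show ?thesis using i(1) by blast
qed

end
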